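(* Let $n\in\mathbb N$, $\nu_1,\dots,\nu_n>0$, let $K$ be a monotone kernel function and let $J$ be an arbitrary $n$-field function. Then $M(\overline S)=m(\overline S)$, and there exists a node system $\mathbf w\in\overline S$ such that $$\overline m(\mathbf w)=M(\overline S)=\min_{\mathbf x\in\overline S}\overline m(\mathbf x).$$ Further, for any equioscillation point $\mathbf e\in\overline S$ we have $\overline m(\mathbf e)=M(\overline S)$; and moreover, if $J$ is upper semicontinuous or $K$ is singular, then there exists an equioscillation point. Furthermore, strict majorization, i.e. $m_i(\mathbf x)>m_i(\mathbf y)$ for every $i=0,1,\dots,n$, cannot hold for any $\mathbf x,\mathbf y\in Y$.
   Context: Write $\underline{\mathbb R}:=\mathbb R\cup\{-\infty\}$. A kernel function is a function $K:(-1,0)\cup(0,1)\to\mathbb R$ that is concave on $(-1,0)$ and on $(0,1)$ and satisfies $\lim_{t\downarrow 0}K(t)=\lim_{t\uparrow 0}K(t)$; it is extended to $K:[-1,1]\to\underline{\mathbb R}$ by its limits at $-1$, $0$, $1$. $K$ is singular if $K(0)=-\infty$. $K$ is monotone if it is non-increasing on $(-1,0)$ and non-decreasing on $(0,1)$. An $n$-field function is a function $J:[0,1]\to\underline{\mathbb R}$ that is bounded above and takes finite values at more than $n$ points, where the points $0$ and $1$ are counted with weight $1/2$ each and points of $(0,1)$ with weight $1$ (so the total weight of $\{t: J(t)>-\infty\}$ exceeds $n$). Let $\overline S:=\{\mathbf y\in[0,1]^n: 0\le y_1\le\dots\le y_n\le 1\}$; its elements are called node systems. Put $y_0:=0$,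 $y_{n+1}:=1$. For $\mathbf y\in\overline S$, $t\in[0,1]$ let $F(\mathbf y,t):=J(t)+\sum_{j=1}^n\nu_jK(t-y_j)$, and for $j=0,1,\dots,n$ let $m_j(\mathbf y):=\sup_{t\in[y_j,y_{j+1}]}F(\mathbf y,t)$. Put $\overline m(\mathbf y):=\max_{0\le j\le n}m_j(\mathbf y)$, $\underline m(\mathbf y):=\min_{0\le j\le n}m_j(\mathbf y)$, $M(\overline S):=\inf_{\mathbf y\in\overline S}\overline m(\mathbf y)$, $m(\overline S):=\sup_{\mathbf y\in\overline S}\underline m(\mathbf y)$, and $Y:=\{\mathbf y\in\overline S: m_j(\mathbf y)\ne-\infty \text{ for } j=0,1,\dots,n\}$. An equioscillation point is a point $\mathbf e\in\overline S$ with $m_0(\mathbf e)=m_1(\mathbf e)=\dots=m_n(\mathbf e)$. *)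

theory Defs
  imports "HOL-Analysis.Analysis"
begin

text \<open>
  The set of reals together with minus infinity is rendered by \<^typ>\<open>ereal\<close>; none of the quantities below takes the value
  \<open>\<infinity>\<close> for data satisfying the hypotheses. A kernel is given by its real values on
  \<open>(-1,0) \<union> (0,1)\<close>; the values of the function \<open>K\<close> elsewhere are ignored.
\<close>

definition kernel_function :: "(real \<Rightarrow> real) \<Rightarrow> bool" where
  "kernel_function K \<longleftrightarrow>
     concave_on {-1<..<0} K \<and> concave_on {0<..<1} K \<and>
     (\<exists>L::ereal. ((\<lambda>t. ereal (K t)) \<longlongrightarrow> L) (at_right 0) \<and>
                ((\<lambda>t. ereal (K t)) \<longlongrightarrow> L) (at_left 0))"

text \<open>
  Extension to \<open>[-1,1]\<close> by limits. The one-sided limits at \<open>-1\<close> and \<open>1\<close> exist in \<^typ>\<open>ereal\<close> by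
  concavity; the limit at \<open>0\<close> exists by \<^const>\<open>kernel_function\<close>. Outside \<open>[-1,1]\<close> the value is
  irrelevant.
\<close>

definition kernel_ext :: "(real \<Rightarrow> real) \<Rightarrow> real \<Rightarrow> ereal" where
  "kernel_ext K t =
     (if t = -1 then Lim (at_right (-1)) (\<lambda>s. ereal (K s))
      else if t = 0 then Lim (at 0) (\<lambda>s. ereal (K s))
      else if t = 1 then Lim (at_left 1) (\<lambda>s. ereal (K s))
      else ereal (K t))"

definition singular_kernel :: "(real \<Rightarrow> real) \<Rightarrow> bool" where
  "singular_kernel K \<longleftrightarrow> kernel_ext K 0 = -\<infinity>"

definition monotone_kernel :: "(real \<Rightarrow> real) \<Rightarrow> bool" where
  "monotone_kernel K \<longleftrightarrow> antimono_on {-1<..<0} K \<and> mono_on {0<..<1} K"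

text \<open>The case of infinitely many points is separate because \<^const>\<open>sum\<close> is \<open>0\<close> on infinite sets.\<close>

definition field_function :: "nat \<Rightarrow> (real \<Rightarrow> ereal) \<Rightarrow> bool" where
  "field_function n J \<longleftrightarrow>
     (\<exists>C::real. \<forall>t\<in>{0..1}. J t \<le> ereal C) \<and>
     (let S = {t\<in>{0..1}. J t \<noteq> -\<infinity>} in
        infinite S \<or> (\<Sum>t\<in>S. if t = 0 \<or> t = 1 then 1/2 else 1) > real n)"

definition usc_on :: "'a::topological_space set \<Rightarrow> ('a \<Rightarrow> ereal) \<Rightarrow> bool" where
  "usc_on S f \<longleftrightarrow> (\<forall>t\<in>S. Limsup (at t within S) f \<le> f t)"

definition node_systems :: "nat \<Rightarrow> (nat \<Rightarrow> real) set" where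
  "node_systems n = {y \<in> {1..n} \<rightarrow>\<^sub>E {0..1}. mono_on {1..n} y}"

definition node :: "nat \<Rightarrow> (nat \<Rightarrow> real) \<Rightarrow> nat \<Rightarrow> real" where
  "node n y j = (if j = 0 then 0 else if j = n + 1 then 1 else y j)"

definition sum_of_translates ::
    "nat \<Rightarrow> (nat \<Rightarrow> real) \<Rightarrow> (real \<Rightarrow> real) \<Rightarrow> (real \<Rightarrow> ereal) \<Rightarrow> (nat \<Rightarrow> real) \<Rightarrow> real \<Rightarrow> ereal" where
  "sum_of_translates n \<nu> K J y t = J t + (\<Sum>j=1..n. ereal (\<nu> j) * kernel_ext K (t - y j))"

definition interval_max ::
    "nat \<Rightarrow> (nat \<Rightarrow> real) \<Rightarrow> (real \<Rightarrow> real) \<Rightarrow> (real \<Rightarrow> ereal) \<Rightarrow> nat \<Rightarrow> (nat \<Rightarrow> real) \<Rightarrow> ereal" where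
  "interval_max n \<nu> K J j y = (SUP t\<in>{node n y j..node n y (j+1)}. sum_of_translates n \<nu> K J y t)"

definition m_upper ::
    "nat \<Rightarrow> (nat \<Rightarrow> real) \<Rightarrow> (real \<Rightarrow> real) \<Rightarrow> (real \<Rightarrow> ereal) \<Rightarrow> (nat \<Rightarrow> real) \<Rightarrow> ereal" where
  "m_upper n \<nu> K J y = Max ((\<lambda>j. interval_max n \<nu> K J j y) ` {0..n})"

definition m_lower ::
    "nat \<Rightarrow> (nat \<Rightarrow> real) \<Rightarrow> (real \<Rightarrow> real) \<Rightarrow> (real \<Rightarrow> ereal) \<Rightarrow> (nat \<Rightarrow> real) \<Rightarrow> ereal" where
  "m_lower n \<nu> K J y = Min ((\<lambda>j. interval_max n \<nu> K J j y) ` {0..n})"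

definition minimax ::
    "nat \<Rightarrow> (nat \<Rightarrow> real) \<Rightarrow> (real \<Rightarrow> real) \<Rightarrow> (real \<Rightarrow> ereal) \<Rightarrow> ereal" where
  "minimax n \<nu> K J = (INF y\<in>node_systems n. m_upper n \<nu> K J y)"

definition maximin ::
    "nat \<Rightarrow> (nat \<Rightarrow> real) \<Rightarrow> (real \<Rightarrow> real) \<Rightarrow> (real \<Rightarrow> ereal) \<Rightarrow> ereal" where
  "maximin n \<nu> K J = (SUP y\<in>node_systems n. m_lower n \<nu> K J y)"

definition regular_nodes ::
    "nat \<Rightarrow> (nat \<Rightarrow> real) \<Rightarrow> (real \<Rightarrow> real) \<Rightarrow> (real \<Rightarrow> ereal) \<Rightarrow> (nat \<Rightarrow> real) set" where
  "regular_nodes n \<nu> K J =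
     {y \<in> node_systems n. \<forall>j\<in>{0..n}. interval_max n \<nu> K J j y \<noteq> -\<infinity>}"

definition equioscillation_point ::
    "nat \<Rightarrow> (nat \<Rightarrow> real) \<Rightarrow> (real \<Rightarrow> real) \<Rightarrow> (real \<Rightarrow> ereal) \<Rightarrow> (nat \<Rightarrow> real) \<Rightarrow> bool" where
  "equioscillation_point n \<nu> K J e \<longleftrightarrow>
     e \<in> node_systems n \<and>
     (\<forall>i\<in>{0..n}. \<forall>j\<in>{0..n}. interval_max n \<nu> K J i e = interval_max n \<nu> K J j e)"

end

theory Submission
  imports Defs
begin

text \<open>
  Everything rests on a comparison of two arbitrary node systems \<open>x\<close> and \<open>y\<close>. Choose \<open>i\<close> minimizing the
  partial sums \<open>\<Sum>j\<le>i. \<nu> j * (y j - x j)\<close>. Then the \<open>i\<close>-th interval of \<open>x\<close> is contained in that of \<open>y\<close>,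
  and on it \<open>F x \<le> F y\<close>, by a weighted majorization inequality for concave monotone functions applied
  to the nodes on the left and on the right separately. Hence \<open>m i x \<le> m i y\<close>, which excludes strict
  majorization and gives maximin \<open>\<le>\<close> minimax.

  For the existence statements, a Knaster--Kuratowski--Mazurkiewicz argument on the simplex of node
  systems yields a point \<open>e\<close> that is, for every \<open>j\<close>, a limit of node systems whose \<open>j\<close>-th interval maximum
  is the global one. Moving the nodes of \<open>e\<close> slightly so that they separate near-maximizers shows that
  maximin is at least the global supremum for \<open>e\<close>, so \<open>e\<close> is a minimizer. If \<open>J\<close> is upper semicontinuous or
  \<open>K\<close> is singular, interval maxima are upper semicontinuous along these limits and \<open>e\<close> is an
  equioscillation point.
\<close>

section \<open>Concave functions and kernels\<close>

text \<open>Moving one endpoint of a chord to the right lowers its slope; doing this for both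
  endpoints in turn settles sorted pairs. Slopes are symmetric in the endpoints and
  \<open>min\<close> and \<open>max\<close> are monotone, so sorting each pair reduces the general
  case to this one.\<close>

lemma concave_on_slope_antimono:
  fixes g :: "real \<Rightarrow> real"
  assumes g: "concave_on S g"
    and S: "x \<in> S" "y \<in> S" "x' \<in> S" "y' \<in> S"
    and le: "x \<le> x'" "y \<le> y'" and ne: "x \<noteq> y" "x' \<noteq> y'"
  shows "(g x' - g y') / (x' - y') \<le> (g x - g y) / (x - y)"
proof -
  have conv: "convex_on S (\<lambda>t. - g t)"
    using g by (simp add: concave_on_def)
  have right: "(g a - g c) / (a - c) \<le> (g a - g b) / (a - b)"
    if "a \<in> S" "c \<in> S" "a < b" "b \<le> c" for a b c
  proof (cases "b = c")
    case False
    have "- ((g a - g b) / (a - b)) \<le> - ((g a - g c) / (a - c))"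
      using convex_on_slope_le(1)[OF conv \<open>a \<in> S\<close> \<open>c \<in> S\<close>, of b] that False
      by (simp add: minus_divide_left)
    then show ?thesis by simp
  qed simp
  have left: "(g b - g c) / (b - c) \<le> (g a - g c) / (a - c)"
    if "a \<in> S" "c \<in> S" "a \<le> b" "b < c" for a b c
  proof (cases "b = a")
    case False
    have "- ((g a - g c) / (a - c)) \<le> - ((g b - g c) / (b - c))"
      using convex_on_slope_le(2)[OF conv \<open>a \<in> S\<close> \<open>c \<in> S\<close>, of b] that False
      by (simp add: minus_divide_left)
    then show ?thesis by simp
  qed simp
  have sorted: "(g a' - g b') / (a' - b') \<le> (g a - g b) / (a - b)"
    if "a \<in> S" "b \<in> S" "a' \<in> S" "b' \<in> S" "a \<le> a'" "b \<le> b'" "a < b" "a' < b'" for a b a' b'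
    using left[of a b' a'] right[of a b' b] that by force
  have swap: "(g b - g a) / (b - a) = (g a - g b) / (a - b)" for a b
    by (metis minus_diff_eq minus_divide_divide)
  have slope: "(g (min a b) - g (max a b)) / (min a b - max a b) = (g a - g b) / (a - b)" for a b
    by (cases "a \<le> b") (use swap in \<open>auto simp: min_def max_def\<close>)
  have "(g (min x' y') - g (max x' y')) / (min x' y' - max x' y') \<le>
        (g (min x y) - g (max x y)) / (min x y - max x y)"
    by (rule sorted) (use S le ne in \<open>auto simp: min_def max_def\<close>)
  then show ?thesis by (simp only: slope)
qed

text \<open>
  Abel summation with the slopes of \<open>g\<close> as weights. The lower bound \<open>q\<close> for the slopes makes the
  induction work although slopes are undefined at indices with \<open>x j = y j\<close>.
\<close>

lemma weighted_majorization_aux: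
  fixes g :: "real \<Rightarrow> real" and x y \<nu> :: "nat \<Rightarrow> real"
  assumes g: "concave_on S g"
    and S: "\<And>j. j < N \<Longrightarrow> x j \<in> S" "\<And>j. j < N \<Longrightarrow> y j \<in> S"
    and mono: "mono_on {..<N} x" "mono_on {..<N} y"
    and partial: "\<And>k. k \<le> N \<Longrightarrow> 0 \<le> (\<Sum>j<k. \<nu> j * (y j - x j))"
    and q: "\<And>j. j < N \<Longrightarrow> x j \<noteq> y j \<Longrightarrow> q \<le> (g (y j) - g (x j)) / (y j - x j)"
  shows "q * (\<Sum>j<N. \<nu> j * (y j - x j)) \<le> (\<Sum>j<N. \<nu> j * (g (y j) - g (x j)))"
  using assms
proof (induction N arbitrary: q)
  case (Suc N)
  let ?d = "\<lambda>j. \<nu> j * (y j - x j)" and ?h = "\<lambda>j. \<nu> j * (g (y j) - g (x j))"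
  note mono' = monotone_onD[OF Suc.prems(4)] monotone_onD[OF Suc.prems(5)]
  have IH: "r * (\<Sum>j<N. ?d j) \<le> (\<Sum>j<N. ?h j)"
    if "\<And>j. j < N \<Longrightarrow> x j \<noteq> y j \<Longrightarrow> r \<le> (g (y j) - g (x j)) / (y j - x j)" for r
    by (rule Suc.IH)
      (use Suc.prems that in \<open>auto intro: monotone_on_subset[of "{..<Suc N}"]\<close>)
  show ?case
  proof (cases "x N = y N")
    case True
    then show ?thesis using IH[of q] Suc.prems(7) by simp
  next
    case False
    \<comment> \<open>Concavity makes the last slope a lower bound for all earlier ones, so it
      replaces \<open>q\<close> in the induction hypothesis. The way back from \<open>c\<close> to
      \<open>q\<close> uses \<open>q \<le> c\<close> and the nonnegativity of the full sum.\<close>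
    define c where "c = (g (y N) - g (x N)) / (y N - x N)"
    have "c \<le> (g (y j) - g (x j)) / (y j - x j)" if "j < N" "x j \<noteq> y j" for j
      unfolding c_def
      by (rule concave_on_slope_antimono[OF Suc.prems(1)])
        (use Suc.prems(2,3) that False mono' in auto)
    then have "c * (\<Sum>j<N. ?d j) \<le> (\<Sum>j<N. ?h j)"
      by (rule IH)
    moreover have "c * ?d N = ?h N"
      using False by (simp add: c_def)
    ultimately have "c * (\<Sum>j<Suc N. ?d j) \<le> (\<Sum>j<Suc N. ?h j)"
      unfolding sum.lessThan_Suc distrib_left by linarith
    moreover have "q * (\<Sum>j<Suc N. ?d j) \<le> c * (\<Sum>j<Suc N. ?d j)"
      using Suc.prems(6)[of "Suc N"] Suc.prems(7)[of N] False
      by (intro mult_right_mono) (auto simp: c_def)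
    ultimately show ?thesis by linarith
  qed
qed simp

text \<open>A nondecreasing function has nonnegative slopes, so \<open>q = 0\<close> is admissible
  in the Abel summation.\<close>

lemma weighted_majorization:
  fixes g :: "real \<Rightarrow> real" and x y \<nu> :: "nat \<Rightarrow> real"
  assumes g: "concave_on S g" "mono_on S g"
    and S: "\<And>j. j < N \<Longrightarrow> x j \<in> S" "\<And>j. j < N \<Longrightarrow> y j \<in> S"
    and mono: "mono_on {..<N} x" "mono_on {..<N} y"
    and partial: "\<And>k. k \<le> N \<Longrightarrow> 0 \<le> (\<Sum>j<k. \<nu> j * (y j - x j))"
  shows "(\<Sum>j<N. \<nu> j * g (x j)) \<le> (\<Sum>j<N. \<nu> j * g (y j))"
proof -
  have "0 \<le> (g b - g a) / (b - a)" if "a \<in> S" "b \<in> S" for a b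
    using that monotone_onD[OF g(2), of a b] monotone_onD[OF g(2), of b a]
    by (cases "a \<le> b") (auto simp: divide_nonpos_nonpos)
  then have "0 * (\<Sum>j<N. \<nu> j * (y j - x j)) \<le> (\<Sum>j<N. \<nu> j * (g (y j) - g (x j)))"
    by (intro weighted_majorization_aux[OF g(1) S mono partial]) (use S in auto)
  then show ?thesis by (simp add: right_diff_distrib sum_subtractf)
qed

text \<open>The kernel on one side of 0 as a function of the distance from 0, to be used for
  \<open>K\<close> and for its reflection. Here \<open>f\<close> carries the real values on the open
  interval and \<open>g\<close> the extension, which may be -\<infinity> at 0.\<close>

locale half_kernel =
  fixes f :: "real \<Rightarrow> real" and g :: "real \<Rightarrow> ereal"
  assumes concave: "concave_on {0<..<1} f"
    and mono: "mono_on {0<..<1} f"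
    and g_eq: "\<And>s. 0 < s \<Longrightarrow> s < 1 \<Longrightarrow> g s = ereal (f s)"
    and lim_0: "(g \<longlongrightarrow> g 0) (at_right 0)"
    and g_1: "g 1 = Lim (at_left 1) (\<lambda>s. ereal (f s))"
begin

text \<open>This is [0,1] or (0,1], according to whether \<open>g 0\<close> is finite: the largest
  domain on which real-valued concavity makes sense.\<close>

abbreviation "finite_part \<equiv> {s\<in>{0..1}. g s \<noteq> -\<infinity>}"

section \<open>Boundedness, limits and continuity of half a kernel\<close>

lemma bounded: "\<exists>B. \<forall>s\<in>{0<..<1}. f s \<le> B"
proof -
  \<comment> \<open>Beyond 1/2, concavity keeps \<open>f\<close> below the line through its points
    at 1/4 and 1/2, whose slope is \<open>(f (1/2) - f (1/4)) * 4\<close>; \<open>B\<close> allows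
    this line a run of length 1.\<close>
  define B where "B = f (1/2) + (f (1/2) - f (1/4)) * 4"
  have "f s \<le> B" if s: "0 < s" "s < 1" for s
  proof (cases "s \<le> 1/2")
    case True
    then have "f s \<le> f (1/2)" "f (1/4) \<le> f (1/2)"
      using s by (auto intro!: monotone_onD[OF mono])
    then show ?thesis by (simp add: B_def)
  next
    case False
    have slope: "(f (1/2) - f s) / (1/2 - s) \<le> (f (1/4) - f (1/2)) / (1/4 - 1/2)"
      by (rule concave_on_slope_antimono[OF concave]) (use s False in auto)
    have "f s - f (1/2) = (f (1/2) - f s) / (1/2 - s) * (s - 1/2)"
      using False by (simp add: field_simps)
    also have "\<dots> \<le> (f (1/2) - f (1/4)) * 4 * (s - 1/2)"
      using slope False by (intro mult_right_mono) auto
    also have "\<dots> \<le> (f (1/2) - f (1/4)) * 4 * 1"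
      using s monotone_onD[OF mono, of "1/4" "1/2"] by (intro mult_left_mono) auto
    finally show ?thesis by (simp add: B_def)
  qed
  then show ?thesis by (auto intro!: exI[of _ B])
qed

text \<open>A nondecreasing function that is bounded above has a finite left limit, namely its
  supremum. Hence 0 is the only point of [0,1] where \<open>g\<close> can be infinite.\<close>

lemma lim_1: "(g \<longlongrightarrow> g 1) (at_left 1)" and g_1_real: "\<exists>l. g 1 = ereal l"
proof -
  obtain B where B: "\<And>s. s \<in> {0<..<1} \<Longrightarrow> f s \<le> B"
    using bounded by blast
  have "(f \<longlongrightarrow> Sup (f ` ({..<1} \<inter> {0<..<1}))) (at 1 within ({..<1} \<inter> {0<..<1}))"
    by (rule Lim_left_bound[where K = B]) (use B in \<open>auto intro!: monotone_onD[OF mono]\<close>)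
  also have "{..<1} \<inter> {0<..<1} = {0<..<1::real}" by auto
  finally obtain l where "(f \<longlongrightarrow> l) (at 1 within {0<..<1})" by blast
  moreover have "at 1 within {0<..<1} = at_left (1::real)"
    by (rule at_within_nhd[of 1 "{0<..}"]) auto
  ultimately have l: "((\<lambda>s. ereal (f s)) \<longlongrightarrow> ereal l) (at_left 1)"
    by simp
  then have g: "g 1 = ereal l"
    unfolding g_1 by (intro tendsto_Lim) auto
  then show "\<exists>l. g 1 = ereal l" by blast
  have "eventually (\<lambda>s. ereal (f s) = g s) (at_left 1)"
    using eventually_at_left_real[OF zero_less_one] by eventually_elim (auto simp: g_eq)
  then show "(g \<longlongrightarrow> g 1) (at_left 1)"
    using l unfolding g by (rule Lim_transform_eventually[rotated])
qed

lemma g_pos_real: "0 < s \<Longrightarrow> s \<le> 1 \<Longrightarrow> \<exists>l. g s = ereal l"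
  using g_1_real g_eq by (cases "s = 1") auto

lemma continuous_f: "continuous_on {0<..<1} f"
  using continuous_on_minus[OF convex_on_continuous[OF _ concave[unfolded concave_on_def]]] by simp

lemma continuous: "continuous_on {0..1} g"
proof (rule continuous_on_IccI)
  fix s :: real assume s: "0 < s" "s < 1"
  have "isCont f s"
    using continuous_f s by (simp add: continuous_on_eq_continuous_at)
  then have "((\<lambda>s. ereal (f s)) \<longlongrightarrow> g s) (at s)"
    using s by (simp add: g_eq isCont_def)
  moreover have "eventually (\<lambda>s. ereal (f s) = g s) (at s)"
    using eventually_at_in_open[of "{0<..<1}" s] s by (auto elim!: eventually_mono simp: g_eq)
  ultimately show "g \<midarrow>s\<rightarrow> g s"
    by (rule Lim_transform_eventually)
qed (use lim_0 lim_1 in auto)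

lemma g_not_PInf: "s \<in> {0..1} \<Longrightarrow> g s \<noteq> \<infinity>"
proof (cases "s = 0")
  case True
  have "eventually (\<lambda>s. g s \<le> ereal (f (1/2))) (at_right 0)"
    using eventually_at_right_real[of 0 "1/2", simplified]
    by eventually_elim (auto simp: g_eq intro!: monotone_onD[OF mono])
  then have "g 0 \<le> ereal (f (1/2))"
    using lim_0 by (intro tendsto_upperbound) auto
  with True show ?thesis by auto
qed (use g_pos_real[of s] in auto)

lemma finite_part_real: "s \<in> finite_part \<Longrightarrow> g s = ereal (real_of_ereal (g s))"
  using g_not_PInf by (cases "g s") auto

lemma finite_part_up: "s \<in> finite_part \<Longrightarrow> s \<le> s' \<Longrightarrow> s' \<le> 1 \<Longrightarrow> s' \<in> finite_part"
  using g_pos_real[of s'] by (cases "s' = 0") auto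

lemma continuous_finite_part: "continuous_on finite_part (\<lambda>s. real_of_ereal (g s))"
proof -
  have "continuous_on finite_part g"
    by (rule continuous_on_subset[OF continuous]) auto
  then have "(g \<longlongrightarrow> ereal (real_of_ereal (g s))) (at s within finite_part)" if "s \<in> finite_part" for s
    using that finite_part_real[OF that] by (simp add: continuous_on_def)
  then show ?thesis
    unfolding continuous_on_def by (blast intro: lim_real_of_ereal)
qed

text \<open>Pulling a point towards 1/2 brings it into the open interval, where \<open>g\<close> is
  \<open>f\<close>. Letting \<open>h\<close> tend to 0 then carries monotonicity and concavity of
  \<open>f\<close> over to the ends of the interval.\<close>

lemma contract_lim:
  assumes "s \<in> finite_part"
  shows "((\<lambda>h. f (s + h * (1/2 - s))) \<longlongrightarrow> real_of_ereal (g s)) (at_right 0)"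
    and "eventually (\<lambda>h. s + h * (1/2 - s) \<in> {0<..<1}) (at_right 0)"
proof -
  have ev: "eventually (\<lambda>h. h \<in> {0<..<1}) (at_right (0::real))"
    by (rule eventually_at_right_real) simp
  have "s + h * (1/2 - s) \<in> {0<..<1}" if h: "h \<in> {0<..<1}" for h
  proof -
    have "s + h * (1/2 - s) = (1 - h) * s + h / 2" by (simp add: field_simps)
    moreover have "0 \<le> (1 - h) * s" "(1 - h) * s \<le> 1 - h"
      using assms h by (auto intro: mult_left_le)
    moreover have "0 < h" "h < 1" using h by auto
    ultimately show ?thesis unfolding greaterThanLessThan_iff by linarith
  qed
  then show ev': "eventually (\<lambda>h. s + h * (1/2 - s) \<in> {0<..<1}) (at_right 0)"
    by (rule eventually_mono[OF ev])
  have "((\<lambda>h. s + h * (1/2 - s)) \<longlongrightarrow> s + 0 * (1/2 - s)) (at_right 0)"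
    by (intro tendsto_intros)
  moreover have "eventually (\<lambda>h. s + h * (1/2 - s) \<in> finite_part) (at_right 0)"
    using ev' by eventually_elim (auto simp: g_eq)
  ultimately have "((\<lambda>h. real_of_ereal (g (s + h * (1/2 - s)))) \<longlongrightarrow> real_of_ereal (g s)) (at_right 0)"
    using continuous_on_tendsto_compose[OF continuous_finite_part, of "\<lambda>h. s + h * (1/2 - s)" s] assms
    by simp
  moreover have "eventually (\<lambda>h. real_of_ereal (g (s + h * (1/2 - s))) = f (s + h * (1/2 - s))) (at_right 0)"
    using ev' by eventually_elim (auto simp: g_eq)
  ultimately show "((\<lambda>h. f (s + h * (1/2 - s))) \<longlongrightarrow> real_of_ereal (g s)) (at_right 0)"
    by (rule Lim_transform_eventually)
qed

lemma mono_finite_part: "mono_on finite_part (\<lambda>s. real_of_ereal (g s))"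
proof (rule monotone_onI)
  fix a b assume a: "a \<in> finite_part" and b: "b \<in> finite_part" and "a \<le> b"
  have "eventually (\<lambda>h. f (a + h * (1/2 - a)) \<le> f (b + h * (1/2 - b))) (at_right 0)"
    using contract_lim(2)[OF a] contract_lim(2)[OF b] eventually_at_right_real[of 0 1, OF zero_less_one]
  proof eventually_elim
    case (elim h)
    have "0 \<le> (1 - h) * (b - a)" using elim \<open>a \<le> b\<close> by auto
    then show ?case
      by (intro monotone_onD[OF mono] elim) (simp add: algebra_simps)
  qed
  then show "real_of_ereal (g a) \<le> real_of_ereal (g b)"
    by (rule tendsto_le[OF _ contract_lim(1)[OF b] contract_lim(1)[OF a], rotated]) simp
qed

lemma convex_finite_part: "convex finite_part"
  unfolding convex_alt
proof safe
  fix a b u :: real assume *: "a \<in> {0..1}" "b \<in> {0..1}" "0 \<le> u" "u \<le> 1" "g a \<noteq> -\<infinity>" "g b \<noteq> -\<infinity>"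
  have le_1: "(1 - u) *\<^sub>R a + u *\<^sub>R b \<in> {0..1}"
    using convex_real_interval(5)[of 0 1] * unfolding convex_alt by blast
  have ge_min: "min a b \<le> (1 - u) *\<^sub>R a + u *\<^sub>R b"
    using convex_bound_le[of "-a" "- min a b" "-b" "1 - u" u] * by auto
  have "min a b \<in> finite_part" using * by (auto simp: min_def)
  then have "(1 - u) *\<^sub>R a + u *\<^sub>R b \<in> finite_part"
    using ge_min le_1 by (intro finite_part_up[OF _ ge_min]) simp_all
  then show "(1 - u) *\<^sub>R a + u *\<^sub>R b \<in> {0..1}" "g ((1 - u) *\<^sub>R a + u *\<^sub>R b) = -\<infinity> \<Longrightarrow> False"
    by auto
qed

lemma concave_finite_part: "concave_on finite_part (\<lambda>s. real_of_ereal (g s))"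
  unfolding concave_on_iff
proof (intro conjI ballI allI impI)
  show "convex finite_part" by (rule convex_finite_part)
  show "u * real_of_ereal (g a) + v * real_of_ereal (g b) \<le> real_of_ereal (g (u *\<^sub>R a + v *\<^sub>R b))"
    if a: "a \<in> finite_part" and b: "b \<in> finite_part" and uv: "0 \<le> u" "0 \<le> v" "u + v = 1" for a b u v
  proof -
    define c where "c = u * a + v * b"
    have c: "c \<in> finite_part"
      using convexD[OF convex_finite_part a b uv] by (simp only: c_def real_scaleR_def)
    have v: "v = 1 - u" using uv by simp
    have "eventually (\<lambda>h. u * f (a + h * (1/2 - a)) + v * f (b + h * (1/2 - b)) \<le> f (c + h * (1/2 - c)))
        (at_right 0)"
      using contract_lim(2)[OF a] contract_lim(2)[OF b]
    proof eventually_elim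
      case (elim h)
      let ?a = "a + h * (1/2 - a)" and ?b = "b + h * (1/2 - b)"
      \<comment> \<open>The contraction towards 1/2 is affine, so it commutes with convex
        combinations.\<close>
      have "u *\<^sub>R (a + h * (1/2 - a)) + v *\<^sub>R (b + h * (1/2 - b)) = c + h * (1/2 - c)"
        by (simp add: c_def v) (simp add: field_simps)
      moreover have "u * f ?a + v * f ?b \<le> f (u *\<^sub>R ?a + v *\<^sub>R ?b)"
        using concave elim uv unfolding concave_on_iff by blast
      ultimately show ?case by simp
    qed
    moreover have "((\<lambda>h. u * f (a + h * (1/2 - a)) + v * f (b + h * (1/2 - b))) \<longlongrightarrow>
        u * real_of_ereal (g a) + v * real_of_ereal (g b)) (at_right 0)"
      by (intro tendsto_add tendsto_mult_left contract_lim(1) a b)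
    ultimately have "u * real_of_ereal (g a) + v * real_of_ereal (g b) \<le> real_of_ereal (g c)"
      by (intro tendsto_le[OF trivial_limit_at_right_real contract_lim(1)[OF c]])
    then show ?thesis by (simp only: c_def real_scaleR_def)
  qed
qed

end

text \<open>Equality of the one-sided limits at 0 makes the two-sided limit in
  \<open>kernel_ext\<close> exist, so both halves share their value there. Reflection turns the left
  half into one of the same kind as the right half.\<close>

lemma half_kernels:
  assumes "kernel_function K" "monotone_kernel K"
  shows "half_kernel K (kernel_ext K)"
    and "half_kernel (\<lambda>s. K (- s)) (\<lambda>s. kernel_ext K (- s))"
proof -
  obtain L where L: "((\<lambda>t. ereal (K t)) \<longlongrightarrow> L) (at_right 0)" "((\<lambda>t. ereal (K t)) \<longlongrightarrow> L) (at_left 0)"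
    using assms(1) unfolding kernel_function_def by blast
  then have "((\<lambda>t. ereal (K t)) \<longlongrightarrow> L) (at 0)"
    by (simp add: filterlim_at_split)
  then have 0: "kernel_ext K 0 = L"
    by (simp add: kernel_ext_def tendsto_Lim)
  show "half_kernel K (kernel_ext K)"
  proof
    show "concave_on {0<..<1} K" "mono_on {0<..<1} K"
      using assms by (simp_all add: kernel_function_def monotone_kernel_def)
    have "eventually (\<lambda>s. ereal (K s) = kernel_ext K s) (at_right 0)"
      using eventually_at_right_real[OF zero_less_one] by eventually_elim (auto simp: kernel_ext_def)
    then show "(kernel_ext K \<longlongrightarrow> kernel_ext K 0) (at_right 0)"
      unfolding 0 by (rule Lim_transform_eventually[OF L(1)])
  qed (auto simp: kernel_ext_def)
  show "half_kernel (\<lambda>s. K (- s)) (\<lambda>s. kernel_ext K (- s))"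
  proof
    have "concave_on {-1<..<0} K" and anti: "antimono_on {-1<..<0} K"
      using assms by (simp_all add: kernel_function_def monotone_kernel_def)
    then have *: "u * K x + v * K y \<le> K (u * x + v * y)"
      if "x \<in> {-1<..<0}" "y \<in> {-1<..<0}" "0 \<le> u" "0 \<le> v" "u + v = 1" for u v x y
      using that by (simp add: concave_on_iff)
    show "concave_on {0<..<1} (\<lambda>s. K (- s))"
      unfolding concave_on_iff
    proof (intro conjI ballI allI impI)
      fix x y u v :: real
      assume "x \<in> {0<..<1}" "y \<in> {0<..<1}" "0 \<le> u" "0 \<le> v" "u + v = 1"
      then show "u * K (- x) + v * K (- y) \<le> K (- (u *\<^sub>R x + v *\<^sub>R y))"
        using *[of "- x" "- y" u v] by simp
    qed simp
    show "mono_on {0<..<1} (\<lambda>s. K (- s))"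
      by (intro monotone_onI monotone_onD[OF anti]) auto
    have "((\<lambda>t. ereal (K (- t))) \<longlongrightarrow> L) (at_right 0)"
      using L(2) by (simp add: at_left_minus filterlim_filtermap)
    moreover have "eventually (\<lambda>s. ereal (K (- s)) = kernel_ext K (- s)) (at_right 0)"
      using eventually_at_right_real[OF zero_less_one] by eventually_elim (auto simp: kernel_ext_def)
    ultimately show "((\<lambda>s. kernel_ext K (- s)) \<longlongrightarrow> kernel_ext K (- 0)) (at_right 0)"
      unfolding minus_zero 0 by (rule Lim_transform_eventually)
    show "kernel_ext K (- 1) = Lim (at_left 1) (\<lambda>s. ereal (K (- s)))"
      by (simp add: kernel_ext_def at_right_minus Topological_Spaces.Lim_def filterlim_filtermap)
  qed (auto simp: kernel_ext_def)
qed

section \<open>Splitting and limits of finite sums\<close>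

lemma sum_split_lessThan:
  fixes h :: "nat \<Rightarrow> 'a::comm_monoid_add"
  assumes "i \<le> n"
  shows "sum h {..<n} = sum h {..<i} + (\<Sum>j<n - i. h (i + j))"
proof -
  have "sum h {..<i + k} = sum h {..<i} + (\<Sum>j<k. h (i + j))" for k
    by (induction k) (auto simp: add.assoc)
  from this[of "n - i"] assms show ?thesis by simp
qed

text \<open>Addition on \<open>ereal\<close> is discontinuous only where opposite infinities meet.
  Excluding \<infinity> from the limits prevents this, and carrying the exclusion along for the sum
  keeps the induction going.\<close>

lemma tendsto_sum_ereal_not_PInf:
  fixes h :: "'b \<Rightarrow> 'a \<Rightarrow> ereal"
  assumes "finite A" "\<And>i. i \<in> A \<Longrightarrow> (h i \<longlongrightarrow> a i) F" "\<And>i. i \<in> A \<Longrightarrow> a i \<noteq> \<infinity>"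
  shows "((\<lambda>x. \<Sum>i\<in>A. h i x) \<longlongrightarrow> (\<Sum>i\<in>A. a i)) F \<and> (\<Sum>i\<in>A. a i) \<noteq> \<infinity>"
  using assms
  by (induction A rule: finite_induct) (auto intro!: tendsto_add_ereal_general)

section \<open>Sums of translates\<close>

locale translates =
  fixes n :: nat and \<nu> :: "nat \<Rightarrow> real" and K :: "real \<Rightarrow> real" and J :: "real \<Rightarrow> ereal"
  assumes pos: "\<And>j. j \<in> {1..n} \<Longrightarrow> 0 < \<nu> j"
    and kernel: "kernel_function K" and monotone: "monotone_kernel K"
    and bounded_above: "\<exists>C::real. \<forall>t\<in>{0..1}. J t \<le> ereal C"
begin

abbreviation "S \<equiv> node_systems n"
abbreviation "I y j \<equiv> {node n y j..node n y (j + 1)}"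
abbreviation "F \<equiv> sum_of_translates n \<nu> K J"
abbreviation "m \<equiv> interval_max n \<nu> K J"
abbreviation "kk \<equiv> kernel_ext K"

text \<open>The translates without the field. They depend continuously on nodes and argument
  together, while \<open>J\<close> is arbitrary, so limit arguments treat the two
  separately.\<close>

definition f :: "(nat \<Rightarrow> real) \<Rightarrow> real \<Rightarrow> ereal" where
  "f y t = (\<Sum>j=1..n. ereal (\<nu> j) * kk (t - y j))"

lemma F_eq: "F y t = J t + f y t"
  by (simp add: sum_of_translates_def f_def)

sublocale right: half_kernel K kk
  by (rule half_kernels[OF kernel monotone])

sublocale left: half_kernel "\<lambda>s. K (- s)" "\<lambda>s. kk (- s)"
  by (rule half_kernels[OF kernel monotone])

lemma kernel_continuous: "continuous_on {-1..1} kk"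
proof -
  have "continuous_on {-1..0} (\<lambda>t. kk (- (- t)))"
    by (intro continuous_on_compose2[OF left.continuous] continuous_intros) auto
  then have "continuous_on ({-1..0} \<union> {0..1}) kk"
    by (intro continuous_on_closed_Un right.continuous) auto
  moreover have "{-1..0} \<union> {0..1} = {-1..1::real}" by auto
  ultimately show ?thesis by simp
qed

lemma kernel_not_PInf: "t \<in> {-1..1} \<Longrightarrow> kk t \<noteq> \<infinity>"
  using right.g_not_PInf[of t] left.g_not_PInf[of "- t"] by (cases "0 \<le> t") auto

lemma nodes_in: "y \<in> S \<Longrightarrow> j \<in> {1..n} \<Longrightarrow> y j \<in> {0..1}"
  by (auto simp: node_systems_def)

lemma nodes_mono: "y \<in> S \<Longrightarrow> 1 \<le> i \<Longrightarrow> i \<le> j \<Longrightarrow> j \<le> n \<Longrightarrow> y i \<le> y j"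
  by (auto simp: node_systems_def monotone_on_def)

lemma node_in: "y \<in> S \<Longrightarrow> j \<le> n + 1 \<Longrightarrow> node n y j \<in> {0..1}"
  using nodes_in[of y j] by (auto simp: node_def)

lemma interval_subset: "y \<in> S \<Longrightarrow> j \<le> n \<Longrightarrow> I y j \<subseteq> {0..1}"
  using node_in[of y j] node_in[of y "j + 1"] by auto

lemma diff_in: "t \<in> {0..1} \<Longrightarrow> s \<in> {0..1} \<Longrightarrow> t - s \<in> {-1..1::real}"
  by auto

text \<open>The extended kernel is continuous as a map into \<open>ereal\<close>, the value
  -\<infinity> included, and never equals \<infinity>; so no sum of opposite infinities occurs in
  the limit.\<close>

lemma translates_tendsto:
  assumes Y: "\<And>k. Y k \<in> S" "\<And>k. T k \<in> {0..1}" and e: "e \<in> S" "t \<in> {0..1}"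
    and lim: "\<And>j. j \<in> {1..n} \<Longrightarrow> (\<lambda>k. Y k j) \<longlonglongrightarrow> e j" "T \<longlonglongrightarrow> t"
  shows "(\<lambda>k. f (Y k) (T k)) \<longlonglongrightarrow> f e t"
    and "f e t \<noteq> \<infinity>"
proof -
  have terms: "(\<lambda>k. ereal (\<nu> j) * kk (T k - Y k j)) \<longlonglongrightarrow> ereal (\<nu> j) * kk (t - e j)"
    if j: "j \<in> {1..n}" for j
  proof (intro tendsto_cmult_ereal)
    show "(\<lambda>k. kk (T k - Y k j)) \<longlonglongrightarrow> kk (t - e j)"
      by (rule continuous_on_tendsto_compose[OF kernel_continuous tendsto_diff[OF lim(2) lim(1)[OF j]]])
        (intro always_eventually allI diff_in nodes_in[OF _ j] Y e)+
  qed simp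
  have terms': "ereal (\<nu> j) * kk (t - e j) \<noteq> \<infinity>" if j: "j \<in> {1..n}" for j
    using kernel_not_PInf[OF diff_in[OF e(2) nodes_in[OF e(1) j]]] pos[OF j]
    by (cases "kk (t - e j)") auto
  note sum = tendsto_sum_ereal_not_PInf[OF finite_atLeastAtMost terms terms']
  show "(\<lambda>k. f (Y k) (T k)) \<longlonglongrightarrow> f e t" "f e t \<noteq> \<infinity>"
    unfolding f_def by (rule sum[THEN conjunct1] sum[THEN conjunct2]; assumption)+
qed

lemma translates_not_PInf: "y \<in> S \<Longrightarrow> t \<in> {0..1} \<Longrightarrow> f y t \<noteq> \<infinity>"
  using translates_tendsto(2)[of "\<lambda>_. y" "\<lambda>_. t" y t] by simp

text \<open>No term can be \<infinity>, so one term -\<infinity> decides the sum. Where the sum is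
  finite it is a real one, to which the majorization inequality applies.\<close>

lemma translates_finite:
  assumes y: "y \<in> S" and t: "t \<in> {0..1}"
  shows "f y t \<noteq> -\<infinity> \<longleftrightarrow> (\<forall>j\<in>{1..n}. kk (t - y j) \<noteq> -\<infinity>)"
    and "f y t \<noteq> -\<infinity> \<Longrightarrow> f y t = ereal (\<Sum>j=1..n. \<nu> j * real_of_ereal (kk (t - y j)))"
proof -
  have inf: "ereal (\<nu> j) * kk (t - y j) \<noteq> \<infinity>"
    "ereal (\<nu> j) * kk (t - y j) = -\<infinity> \<longleftrightarrow> kk (t - y j) = -\<infinity>" if j: "j \<in> {1..n}" for j
    using kernel_not_PInf[OF diff_in[OF t nodes_in[OF y j]]] pos[OF j]
    by (cases "kk (t - y j)"; simp)+
  have "sum h A = -\<infinity> \<longleftrightarrow> (\<exists>a\<in>A. h a = -\<infinity>)"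
    if "finite A" "\<And>a. a \<in> A \<Longrightarrow> h a \<noteq> \<infinity>" for h :: "nat \<Rightarrow> ereal" and A
    using that by (induction A rule: finite_induct) (auto simp: sum_Pinfty)
  from this[of "{1..n}" "\<lambda>j. ereal (\<nu> j) * kk (t - y j)"]
  have "f y t = -\<infinity> \<longleftrightarrow> (\<exists>j\<in>{1..n}. ereal (\<nu> j) * kk (t - y j) = -\<infinity>)"
    unfolding f_def using inf by auto
  then show *: "f y t \<noteq> -\<infinity> \<longleftrightarrow> (\<forall>j\<in>{1..n}. kk (t - y j) \<noteq> -\<infinity>)"
    using inf by auto
  assume "f y t \<noteq> -\<infinity>"
  then have "ereal (\<nu> j) * kk (t - y j) = ereal (\<nu> j * real_of_ereal (kk (t - y j)))" if j: "j \<in> {1..n}" for j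
    using * j kernel_not_PInf[OF diff_in[OF t nodes_in[OF y j]]] by (cases "kk (t - y j)") auto
  then show "f y t = ereal (\<Sum>j=1..n. \<nu> j * real_of_ereal (kk (t - y j)))"
    unfolding f_def by simp
qed

text \<open>
  The interval is the one at which the partial sums \<open>D\<close> of the weighted displacements of the nodes
  are minimal: seen from it, all accumulated displacements towards and away from \<open>t\<close> have the right
  sign on either side, so that the weighted majorization inequality applies to both sides.
\<close>

lemma interval_comparison:
  assumes x: "x \<in> S" and y: "y \<in> S"
  obtains i where "i \<le> n" "I x i \<subseteq> I y i" "\<And>t. t \<in> I x i \<Longrightarrow> F x t \<le> F y t"
proof -
  \<comment> \<open>\<open>d j\<close> belongs to node \<open>j + 1\<close>, so \<open>D k\<close>
    accumulates the displacements of the nodes from 1 to \<open>k\<close>, and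
    \<open>D 0 = 0\<close>.\<close>
  define d where "d j = \<nu> (Suc j) * (y (Suc j) - x (Suc j))" for j
  define D where "D k = (\<Sum>j<k. d j)" for k
  have "Min (D ` {..n}) \<in> D ` {..n}"
    by (rule Min_in) auto
  then obtain i where "Min (D ` {..n}) = D i" "i \<in> {..n}"
    by (rule imageE)
  then have i: "i \<le> n" and Min_D: "D i = Min (D ` {..n})"
    by simp_all
  have min: "D i \<le> D k" if "k \<le> n" for k
    using that by (simp add: Min_D)
  have part_right: "0 \<le> (\<Sum>j<k. \<nu> (Suc (i + j)) * (y (Suc (i + j)) - x (Suc (i + j))))" if "k \<le> n - i" for k
    using min[of "i + k"] sum_split_lessThan[of i "i + k" d] that i by (simp add: D_def d_def)
  \<comment> \<open>To the left of the interval the nodes are counted backwards from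
    \<open>i\<close>, and \<open>D i \<le> D (i - k)\<close> gives displacements of the opposite
    sign.\<close>
  have part_left: "0 \<le> (\<Sum>j<k. \<nu> (i - j) * (x (i - j) - y (i - j)))" if "k \<le> i" for k
  proof -
    have "D i = D (i - k) + (\<Sum>j<k. d (i - k + j))"
      using sum_split_lessThan[of "i - k" i d] that by (simp add: D_def)
    also have "(\<Sum>j<k. d (i - k + j)) = (\<Sum>j<k. d (i - k + (k - Suc j)))"
      by (rule sum.nat_diff_reindex[symmetric])
    also have "\<dots> = (\<Sum>j<k. \<nu> (i - j) * (y (i - j) - x (i - j)))"
      using that by (intro sum.cong refl) (auto simp: d_def Suc_diff_Suc)
    also have "\<dots> = - (\<Sum>j<k. \<nu> (i - j) * (x (i - j) - y (i - j)))"
      by (simp add: sum_negf[symmetric] algebra_simps)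
    finally show ?thesis using min[of "i - k"] i by simp
  qed
  \<comment> \<open>Partial sums of length one show how the two nodes bounding the interval move,
    which yields the inclusion.\<close>
  have next_le: "x (Suc i) \<le> y (Suc i)" if "i < n"
    using part_right[of 1] pos[of "Suc i"] that by (simp add: zero_le_mult_iff)
  have prev_le: "y i \<le> x i" if "0 < i"
    using part_left[of 1] pos[of i] that i by (simp add: zero_le_mult_iff)
  have sub: "I x i \<subseteq> I y i"
    using next_le prev_le i by (auto simp: node_def)
  have "F x t \<le> F y t" if t: "t \<in> I x i" for t
  proof (cases "f x t = -\<infinity>")
    case True
    \<comment> \<open>In \<open>ereal\<close> the sum \<infinity> + -\<infinity> is \<infinity>, so
      this value of the field must be excluded before concluding that \<open>F x t\<close> is
      -\<infinity>.\<close>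
    have "J t \<noteq> \<infinity>"
      using bounded_above t interval_subset[OF x i] by fastforce
    with True show ?thesis
      by (cases "J t") (auto simp: F_eq)
  next
    case False
    define k where "k s = real_of_ereal (kk s)" for s
    have t01: "t \<in> {0..1}"
      using t interval_subset[OF x i] by blast
    have fin: "kk (t - x j) \<noteq> -\<infinity>" if "j \<in> {1..n}" for j
      using translates_finite(1)[OF x t01] False that by blast
    \<comment> \<open>Finiteness passes from \<open>x\<close> to \<open>y\<close>: every node of
      \<open>y\<close> on this side is at least as far from \<open>t\<close> as the bounding node of
      \<open>x\<close>, and the finite part is closed under going farther.\<close>
    have x_left: "t - x j \<in> right.finite_part" and y_left: "t - y j \<in> right.finite_part"
      if j: "j \<in> {1..i}" for j
    proof -
      have "x j \<le> x i" "x i \<le> t" "y j \<le> x i"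
        using nodes_mono[OF x, of j i] nodes_mono[OF y, of j i] prev_le j i t by (auto simp: node_def)
      then show "t - x j \<in> right.finite_part"
        using fin[of j] nodes_in[OF x, of j] j i t01 by auto
      have "t - x i \<in> right.finite_part"
        using fin[of i] nodes_in[OF x, of i] j i t01 \<open>x i \<le> t\<close> by auto
      then show "t - y j \<in> right.finite_part"
        by (rule right.finite_part_up) (use \<open>y j \<le> x i\<close> nodes_in[OF y, of j] j i t01 in auto)
    qed
    have x_right: "x j - t \<in> left.finite_part" and y_right: "y j - t \<in> left.finite_part"
      if j: "j \<in> {Suc i..n}" for j
    proof -
      have "x (Suc i) \<le> x j" "t \<le> x (Suc i)" "x (Suc i) \<le> y j"
        using nodes_mono[OF x, of "Suc i" j] nodes_mono[OF y, of "Suc i" j] next_le j i t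
        by (auto simp: node_def)
      then show "x j - t \<in> left.finite_part"
        using fin[of j] nodes_in[OF x, of j] j i t01 by auto
      have "x (Suc i) - t \<in> left.finite_part"
        using fin[of "Suc i"] nodes_in[OF x, of "Suc i"] j i t01 \<open>t \<le> x (Suc i)\<close> by auto
      then show "y j - t \<in> left.finite_part"
        by (rule left.finite_part_up) (use \<open>x (Suc i) \<le> y j\<close> nodes_in[OF y, of j] j i t01 in auto)
    qed
    have fin_y: "kk (t - y j) \<noteq> -\<infinity>" if "j \<in> {1..n}" for j
      using y_left[of j] y_right[of j] that by (cases "j \<le> i") auto
    have fy: "f y t \<noteq> -\<infinity>"
      using translates_finite(1)[OF y t01] fin_y by blast
    \<comment> \<open>Both sides are written in terms of the distance from \<open>t\<close>, listed
      from the nearest node outwards. Then the distances increase, and each half of the kernel is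
      concave and nondecreasing in them.\<close>
    have "(\<Sum>j<n - i. \<nu> (Suc (i + j)) * k (- (x (Suc (i + j)) - t))) \<le>
        (\<Sum>j<n - i. \<nu> (Suc (i + j)) * k (- (y (Suc (i + j)) - t)))"
      unfolding k_def
    proof (rule weighted_majorization[OF left.concave_finite_part left.mono_finite_part])
      show "mono_on {..<n - i} (\<lambda>j. x (Suc (i + j)) - t)"
        by (intro monotone_onI) (auto intro!: nodes_mono[OF x])
      show "mono_on {..<n - i} (\<lambda>j. y (Suc (i + j)) - t)"
        by (intro monotone_onI) (auto intro!: nodes_mono[OF y])
      show "0 \<le> (\<Sum>j<l. \<nu> (Suc (i + j)) * (y (Suc (i + j)) - t - (x (Suc (i + j)) - t)))" if "l \<le> n - i" for l
        using part_right[OF that] by simp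
    qed (use x_right y_right in auto)
    moreover have "(\<Sum>j<i. \<nu> (i - j) * k (t - x (i - j))) \<le> (\<Sum>j<i. \<nu> (i - j) * k (t - y (i - j)))"
      unfolding k_def
    proof (rule weighted_majorization[OF right.concave_finite_part right.mono_finite_part])
      show "mono_on {..<i} (\<lambda>j. t - x (i - j))"
        using i by (intro monotone_onI) (auto intro!: nodes_mono[OF x])
      show "mono_on {..<i} (\<lambda>j. t - y (i - j))"
        using i by (intro monotone_onI) (auto intro!: nodes_mono[OF y])
      show "0 \<le> (\<Sum>j<l. \<nu> (i - j) * (t - y (i - j) - (t - x (i - j))))" if "l \<le> i" for l
        using part_left[OF that] by simp
    qed (use x_left y_left in auto)
    moreover have "(\<Sum>j=1..n. \<nu> j * k (t - z j)) =
        (\<Sum>j<i. \<nu> (i - j) * k (t - z (i - j))) +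
        (\<Sum>j<n - i. \<nu> (Suc (i + j)) * k (- (z (Suc (i + j)) - t)))" for z
    proof -
      have "(\<Sum>j=1..n. \<nu> j * k (t - z j)) = (\<Sum>j<n. \<nu> (Suc j) * k (t - z (Suc j)))"
        by (simp add: sum.atLeast1_atMost_eq)
      also have "\<dots> = (\<Sum>j<i. \<nu> (Suc j) * k (t - z (Suc j))) +
          (\<Sum>j<n - i. \<nu> (Suc (i + j)) * k (t - z (Suc (i + j))))"
        by (rule sum_split_lessThan[OF i])
      also have "(\<Sum>j<i. \<nu> (Suc j) * k (t - z (Suc j))) =
          (\<Sum>j<i. \<nu> (Suc (i - Suc j)) * k (t - z (Suc (i - Suc j))))"
        by (rule sum.nat_diff_reindex[symmetric])
      also have "\<dots> = (\<Sum>j<i. \<nu> (i - j) * k (t - z (i - j)))"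
        by (intro sum.cong refl) (auto simp: Suc_diff_Suc)
      finally show ?thesis by simp
    qed
    ultimately have "f x t \<le> f y t"
      using translates_finite(2)[OF x t01 False] translates_finite(2)[OF y t01 fy] by (simp add: k_def)
    then show ?thesis
      unfolding F_eq by (rule add_left_mono)
  qed
  with i sub that show ?thesis by blast
qed

end

section \<open>A covering lemma for node systems\<close>

text \<open>
  A form of the Knaster--Kuratowski--Mazurkiewicz theorem. The barycentric coordinates of a node
  system are the lengths of its intervals. Grid points of the cube are retracted to node systems by
  taking running maxima, which turns a vanishing coordinate into a degenerate interval.
\<close>

lemma kuhn_colouring:
  fixes c :: "(nat \<Rightarrow> real) \<Rightarrow> nat"
  assumes p: "0 < p"
    and colour: "\<And>y. y \<in> node_systems n \<Longrightarrow> c y \<le> n \<and> node n y (c y) < node n y (c y + 1)"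
  obtains Y where "\<And>j. j \<le> n \<Longrightarrow> Y j \<in> node_systems n" "\<And>j. j \<le> n \<Longrightarrow> c (Y j) = j"
    "\<And>i j l. i \<le> n \<Longrightarrow> j \<le> n \<Longrightarrow> l \<in> {1..n} \<Longrightarrow> \<bar>Y i l - Y j l\<bar> \<le> 1 / real p"
proof -
  \<comment> \<open>The coordinates of \<open>z\<close> are numbered from 0 and the nodes from 1, so
    node \<open>i\<close> is the maximum of the first \<open>i\<close> coordinates.\<close>
  define y :: "(nat \<Rightarrow> nat) \<Rightarrow> nat \<Rightarrow> real"
    where "y z = restrict (\<lambda>i. real (Max (z ` {..<i})) / real p) {1..n}" for z
  \<comment> \<open>\<open>reduced\<close> finds the first nonzero label, which is to be the colour.
    The clause \<open>z i = p\<close> meets the boundary condition of Kuhn's lemma on the upper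
    faces.\<close>
  define lab :: "(nat \<Rightarrow> nat) \<Rightarrow> nat \<Rightarrow> nat" where "lab z i = (if i = c (y z) \<or> z i = p then 1 else 0)" for z i
  have ne: "{..<i} \<noteq> {}" if "1 \<le> i" for i :: nat
    using that by (simp add: lessThan_empty_iff)
  have y_in: "y z \<in> node_systems n" if z: "\<forall>j. z j \<le> p" for z
    unfolding node_systems_def
  proof (intro CollectI conjI)
    show "y z \<in> {1..n} \<rightarrow>\<^sub>E {0..1}"
    proof (rule PiE_I)
      fix i assume i: "i \<in> {1..n}"
      then have "Max (z ` {..<i}) \<le> p"
        using z ne[of i] by (subst Max_le_iff) auto
      with i p show "y z i \<in> {0..1}" by (simp add: y_def)
    qed (auto simp: y_def)
    show "mono_on {1..n} (y z)"
    proof (rule monotone_onI)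
      fix i j assume ij: "i \<in> {1..n}" "j \<in> {1..n}" "i \<le> j"
      then have "Max (z ` {..<i}) \<le> Max (z ` {..<j})"
        using ne[of i] by (intro Max_mono image_mono) auto
      with ij p show "y z i \<le> y z j" by (simp add: y_def divide_right_mono)
    qed
  qed
  have lab_0: "lab z i = 0" if z: "\<forall>j. z j \<le> p" and i: "i < n" "z i = 0" for z i
  proof -
    \<comment> \<open>A zero coordinate does not raise the running maximum, so interval
      \<open>i\<close> is degenerate and cannot be the colour.\<close>
    have "node n (y z) (i + 1) = node n (y z) i"
    proof (cases "i = 0")
      case False
      have "Max (z ` {..<Suc i}) = Max (z ` {..<i})"
        using False i by (simp add: lessThan_Suc lessThan_empty_iff)
      with False i show ?thesis by (simp add: y_def node_def)
    qed (use i in \<open>auto simp: y_def node_def lessThan_Suc\<close>)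
    then have "i \<noteq> c (y z)"
      using colour[OF y_in[OF z]] by auto
    with i p show ?thesis by (simp add: lab_def)
  qed
  have red: "reduced n (lab z) = c (y z)" if z: "\<forall>j. z j \<le> p" for z
  proof (rule reduced_labelling_unique)
    note col = colour[OF y_in[OF z]]
    have node_le: "node n (y z) j \<le> 1" if "j \<le> n + 1" for j
      using y_in[OF z] that by (cases "j \<in> {1..n}") (auto simp: node_def node_systems_def y_def)
    show "c (y z) \<le> n" using col by simp
    show "\<forall>i<c (y z). lab z i = 0"
    proof safe
      fix i assume i: "i < c (y z)"
      \<comment> \<open>A coordinate \<open>p\<close> before the colour would push the left end of
        the coloured interval to 1 and make it degenerate.\<close>
      have "z i \<noteq> p"
      proof
        assume "z i = p"
        then have "p \<le> Max (z ` {..<c (y z)})"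
          using i by (intro Max_ge) auto
        then have "1 \<le> node n (y z) (c (y z))"
          using i col p by (simp add: node_def y_def)
        then show False
          using col node_le[of "c (y z) + 1"] by simp
      qed
      with i show "lab z i = 0" by (simp add: lab_def)
    qed
    show "c (y z) = n \<or> lab z (c (y z)) \<noteq> 0" by (simp add: lab_def)
  qed
  have "odd (card {s. ksimplex p n s \<and> (reduced n \<circ> lab) ` s = {..n}})"
    by (rule kuhn_combinatorial) (use p lab_0 in \<open>auto simp: lab_def\<close>)
  then have "{s. ksimplex p n s \<and> (reduced n \<circ> lab) ` s = {..n}} \<noteq> {}"
    using odd_card_imp_not_empty by blast
  then obtain s b u where s: "kuhn_simplex p n b u s" and image: "(reduced n \<circ> lab) ` s = {..n}"
    by (auto elim: ksimplex.cases)
  interpret kuhn_simplex p n b u s by (rule s)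
  have s_le: "z j \<le> p" if "z \<in> s" for z j
    using s_space out_eq_p[OF that, of j] that by (cases "j < n") auto
  \<comment> \<open>The vertices of a Kuhn simplex arise from its base by raising each coordinate at
    most once.\<close>
  have s_close: "z j \<le> z' j + 1" if "z \<in> s" "z' \<in> s" for z z' j
    using that by (auto simp: s_eq enum_def)
  have "\<exists>z\<in>s. reduced n (lab z) = j" if "j \<le> n" for j
  proof -
    have "j \<in> (reduced n \<circ> lab) ` s" using that image by simp
    then show ?thesis by auto
  qed
  then obtain Z where Z: "\<And>j. j \<le> n \<Longrightarrow> Z j \<in> s" "\<And>j. j \<le> n \<Longrightarrow> reduced n (lab (Z j)) = j"
    by metis
  have close: "y z l \<le> y z' l + 1 / real p" if "z \<in> s" "z' \<in> s" "l \<in> {1..n}" for z z' l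
  proof -
    have "Max (z ` {..<l}) \<le> Max (z' ` {..<l}) + 1"
    proof (subst Max_le_iff)
      show "\<forall>a\<in>z ` {..<l}. a \<le> Max (z' ` {..<l}) + 1"
      proof safe
        fix j assume "j < l"
        then have "z' j \<le> Max (z' ` {..<l})" by (intro Max_ge) auto
        with s_close[OF that(1,2), of j] show "z j \<le> Max (z' ` {..<l}) + 1" by linarith
      qed
    qed (use that ne in auto)
    then have "real (Max (z ` {..<l})) \<le> real (Max (z' ` {..<l})) + 1" by linarith
    then have "real (Max (z ` {..<l})) / real p \<le> (real (Max (z' ` {..<l})) + 1) / real p"
      by (rule divide_right_mono) simp
    with that show ?thesis by (simp add: y_def add_divide_distrib)
  qed
  show thesis
  proof
    show "y (Z j) \<in> node_systems n" if "j \<le> n" for j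
      using y_in s_le Z(1)[OF that] by blast
    show "c (y (Z j)) = j" if "j \<le> n" for j
      using red[of "Z j"] s_le Z[OF that] by simp
    show "\<bar>y (Z i) l - y (Z j) l\<bar> \<le> 1 / real p" if "i \<le> n" "j \<le> n" "l \<in> {1..n}" for i j l
      using close[OF Z(1)[OF that(1)] Z(1)[OF that(2)] that(3)]
        close[OF Z(1)[OF that(2)] Z(1)[OF that(1)] that(3)] by linarith
  qed
qed

text \<open>Node systems are functions on an index set, so compactness is extracted one coordinate
  at a time, refining the subsequence.\<close>

lemma simultaneous_convergent_subsequence:
  fixes X :: "nat \<Rightarrow> 'i \<Rightarrow> real"
  assumes "finite A" "\<And>k i. i \<in> A \<Longrightarrow> X k i \<in> {a..b}"
  obtains r l where "strict_mono (r :: nat \<Rightarrow> nat)" "\<And>i. i \<in> A \<Longrightarrow> l i \<in> {a..b}"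
    "\<And>i. i \<in> A \<Longrightarrow> (\<lambda>k. X (r k) i) \<longlonglongrightarrow> l i"
proof -
  have "\<exists>r l. strict_mono (r :: nat \<Rightarrow> nat) \<and> (\<forall>i\<in>A. l i \<in> {a..b} \<and> (\<lambda>k. X (r k) i) \<longlonglongrightarrow> l i)"
    using assms
  proof (induction A rule: finite_induct)
    case empty
    show ?case using strict_mono_id by auto
  next
    case (insert i A)
    then obtain r l where r: "strict_mono (r :: nat \<Rightarrow> nat)"
      and l: "\<forall>i\<in>A. l i \<in> {a..b} \<and> (\<lambda>k. X (r k) i) \<longlonglongrightarrow> l i"
      using insert.IH insert.prems by blast
    have "seq_compact {a..b}"
      using compact_imp_seq_compact compact_Icc by blast
    moreover have "\<forall>k. X (r k) i \<in> {a..b}"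
      using insert.prems by blast
    ultimately obtain l' r' where r': "l' \<in> {a..b}" "strict_mono r'" "((\<lambda>k. X (r k) i) \<circ> r') \<longlonglongrightarrow> l'"
      by (rule seq_compactE)
    have "(\<lambda>k. X ((r \<circ> r') k) j) \<longlonglongrightarrow> l j" if "j \<in> A" for j
      using LIMSEQ_subseq_LIMSEQ[OF conjunct2[OF bspec[OF l that]] r'(2)] by (simp add: o_def)
    moreover have "(\<lambda>k. X ((r \<circ> r') k) i) \<longlonglongrightarrow> l'"
      using r'(3) by (simp add: o_def)
    ultimately have "\<forall>j\<in>insert i A. (l(i := l')) j \<in> {a..b} \<and> (\<lambda>k. X ((r \<circ> r') k) j) \<longlonglongrightarrow> (l(i := l')) j"
      using l r'(1) insert.hyps by auto
    moreover have "strict_mono (r \<circ> r')"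
      using r r'(2) by (rule strict_mono_o)
    ultimately show ?case by blast
  qed
  with that show thesis by blast
qed

section \<open>Interval maxima\<close>

context translates
begin

lemma F_le_m: "t \<in> I y j \<Longrightarrow> F y t \<le> m j y"
  unfolding interval_max_def by (rule SUP_upper)

lemma less_m: "c < m j y \<longleftrightarrow> (\<exists>t\<in>I y j. c < F y t)"
  unfolding interval_max_def by (rule less_SUP_iff)

lemma m_le_upper: "j \<le> n \<Longrightarrow> m j y \<le> m_upper n \<nu> K J y"
  unfolding m_upper_def by (intro Max_ge) auto

lemma m_upper_attained: "\<exists>j\<le>n. m_upper n \<nu> K J y = m j y"
proof -
  have "m_upper n \<nu> K J y \<in> (\<lambda>j. m j y) ` {0..n}"
    unfolding m_upper_def by (rule Max_in) auto
  then show ?thesis by auto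
qed

lemma m_lower_le: "j \<le> n \<Longrightarrow> m_lower n \<nu> K J y \<le> m j y"
  unfolding m_lower_def by (intro Min_le) auto

lemma le_m_lower: "(\<And>j. j \<le> n \<Longrightarrow> c \<le> m j y) \<Longrightarrow> c \<le> m_lower n \<nu> K J y"
  unfolding m_lower_def by (subst Min_ge_iff) auto

text \<open>Take the last node that is at most \<open>t\<close> and below 1: its successor exceeds
  \<open>t\<close> or equals 1. Asking for a node below 1 takes care of
  \<open>t = 1\<close>.\<close>

lemma nondegenerate_interval:
  assumes "y \<in> S" "t \<in> {0..1}"
  shows "\<exists>j\<le>n. t \<in> I y j \<and> node n y j < node n y (j + 1)"
proof -
  define P where "P j \<longleftrightarrow> j \<le> n \<and> node n y j \<le> t \<and> node n y j < 1" for j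
  define i where "i = (GREATEST j. P j)"
  have "P 0" using assms by (simp add: P_def node_def)
  then have i: "P i"
    unfolding i_def by (rule GreatestI_nat[of P 0 n]) (simp add: P_def)
  have max: "j \<le> i" if "P j" for j
    unfolding i_def using that by (rule Greatest_le_nat[of P j n]) (simp add: P_def)
  show ?thesis
  proof (cases "i = n")
    case True
    then show ?thesis
      using i assms by (intro exI[of _ n]) (auto simp: P_def node_def)
  next
    case False
    then have "\<not> P (i + 1)" "i + 1 \<le> n" using max[of "i + 1"] i by (auto simp: P_def)
    then show ?thesis
      using i assms node_in[of y "i + 1"] by (intro exI[of _ i]) (auto simp: P_def)
  qed
qed

lemma F_le_upper: "y \<in> S \<Longrightarrow> t \<in> {0..1} \<Longrightarrow> F y t \<le> m_upper n \<nu> K J y"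
  using nondegenerate_interval[of y t] F_le_m[of t y] m_le_upper[of _ y] order_trans by meson

text \<open>This supplies an admissible colouring for the covering lemma. A degenerate interval is a
  single point of some nondegenerate one, so it cannot dominate alone.\<close>

lemma dominant_interval:
  assumes "y \<in> S"
  shows "\<exists>j\<le>n. node n y j < node n y (j + 1) \<and> m j y = m_upper n \<nu> K J y"
proof -
  define A where "A = {j. j \<le> n \<and> node n y j < node n y (j + 1)}"
  have "A \<noteq> {}" using nondegenerate_interval[OF assms, of 0] by (auto simp: A_def)
  moreover have "finite A" by (simp add: A_def)
  ultimately have "Max ((\<lambda>j. m j y) ` A) \<in> (\<lambda>j. m j y) ` A"
    by (intro Max_in) auto
  then obtain j where "Max ((\<lambda>j. m j y) ` A) = m j y" and j: "j \<in> A"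
    by (rule imageE)
  then have max: "m k y \<le> m j y" if "k \<in> A" for k
    using that \<open>finite A\<close> by (metis Max_ge finite_imageI imageI)
  have "m k y \<le> m j y" if "k \<le> n" for k
    unfolding interval_max_def[of n \<nu> K J k]
  proof (rule SUP_least)
    fix t assume "t \<in> I y k"
    then have "t \<in> {0..1}" using interval_subset[OF assms that] by blast
    then obtain i where "i \<in> A" "t \<in> I y i"
      using nondegenerate_interval[OF assms] by (auto simp: A_def)
    then show "F y t \<le> m j y"
      using F_le_m[of t y i] max[of i] by simp
  qed
  then have "m_upper n \<nu> K J y \<le> m j y"
    using m_upper_attained[of y] by auto
  with j m_le_upper[of j y] show ?thesis
    unfolding A_def by (intro exI[of _ j]) auto
qed

text \<open>Membership of \<open>e\<close> in the closure of the set where interval \<open>j\<close>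
  dominates. For arbitrary \<open>J\<close> these sets need not be closed, so the covering argument
  is run with their closures.\<close>

definition dominant_limit :: "nat \<Rightarrow> (nat \<Rightarrow> real) \<Rightarrow> bool" where
  "dominant_limit j e \<longleftrightarrow>
     (\<exists>Y. (\<forall>k. Y k \<in> S \<and> m j (Y k) = m_upper n \<nu> K J (Y k)) \<and>
          (\<forall>l\<in>{1..n}. (\<lambda>k. Y k l) \<longlonglongrightarrow> e l))"

text \<open>For each mesh 1/(k+1) there is one node system of every colour, all within the mesh of
  each other. A limit along a subsequence for colour 0 is therefore the limit for all
  colours.\<close>

lemma common_dominant_limit: "\<exists>e\<in>S. \<forall>j\<le>n. dominant_limit j e"
proof -
  obtain c where c: "\<And>y. y \<in> S \<Longrightarrow> c y \<le> n \<and> node n y (c y) < node n y (c y + 1)"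
    and c_max: "\<And>y. y \<in> S \<Longrightarrow> m (c y) y = m_upper n \<nu> K J y"
    using dominant_interval by metis
  have "\<exists>Y. (\<forall>j\<le>n. Y j \<in> S \<and> c (Y j) = j) \<and>
      (\<forall>i\<le>n. \<forall>j\<le>n. \<forall>l\<in>{1..n}. \<bar>Y i l - Y j l\<bar> \<le> 1 / real (Suc k))" for k
  proof -
    obtain Y where "\<And>j. j \<le> n \<Longrightarrow> Y j \<in> S" "\<And>j. j \<le> n \<Longrightarrow> c (Y j) = j"
      "\<And>i j l. i \<le> n \<Longrightarrow> j \<le> n \<Longrightarrow> l \<in> {1..n} \<Longrightarrow> \<bar>Y i l - Y j l\<bar> \<le> 1 / real (Suc k)"
      using kuhn_colouring[OF zero_less_Suc c] by blast
    then show ?thesis by blast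
  qed
  then obtain W where W: "\<And>k j. j \<le> n \<Longrightarrow> W k j \<in> S" "\<And>k j. j \<le> n \<Longrightarrow> c (W k j) = j"
    and close: "\<And>k i j l. i \<le> n \<Longrightarrow> j \<le> n \<Longrightarrow> l \<in> {1..n} \<Longrightarrow> \<bar>W k i l - W k j l\<bar> \<le> 1 / real (Suc k)"
    by metis
  obtain r :: "nat \<Rightarrow> nat" and l where r: "strict_mono r" and l: "\<And>i. i \<in> {1..n} \<Longrightarrow> l i \<in> {0..1}"
    and lim: "\<And>i. i \<in> {1..n} \<Longrightarrow> (\<lambda>k. W (r k) 0 i) \<longlonglongrightarrow> l i"
    by (rule simultaneous_convergent_subsequence[of "{1..n}" "\<lambda>k. W k 0" 0 1])
      (use nodes_in W(1)[of 0] in auto)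
  define e where "e = restrict l {1..n}"
  have e: "e \<in> S"
    unfolding node_systems_def
  proof (intro CollectI conjI)
    show "e \<in> {1..n} \<rightarrow>\<^sub>E {0..1}" using l by (auto simp: e_def)
    show "mono_on {1..n} e"
    proof (rule monotone_onI)
      fix i j assume ij: "i \<in> {1..n}" "j \<in> {1..n}" "i \<le> j"
      then have "l i \<le> l j"
        using nodes_mono[OF W(1)[of 0]] by (intro LIMSEQ_le[OF lim lim]) auto
      with ij show "e i \<le> e j" by (simp add: e_def)
    qed
  qed
  have "(\<lambda>k. W (r k) j i) \<longlonglongrightarrow> e i" if j: "j \<le> n" and i: "i \<in> {1..n}" for j i
  proof -
    have "(\<lambda>k. 1 / real (Suc (r k))) \<longlonglongrightarrow> 0"
      using LIMSEQ_subseq_LIMSEQ[OF LIMSEQ_Suc[OF lim_1_over_n] r] by (simp add: o_def)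
    then have "(\<lambda>k. W (r k) j i - W (r k) 0 i) \<longlonglongrightarrow> 0"
      by (rule Lim_null_comparison[rotated]) (use close[OF j _ i] in auto)
    from tendsto_add[OF this lim[OF i]] show ?thesis using i by (simp add: e_def)
  qed
  moreover have "m j (W (r k) j) = m_upper n \<nu> K J (W (r k) j)" if "j \<le> n" for j k
    using c_max[OF W(1)[OF that]] W(2)[OF that] by simp
  ultimately have "dominant_limit j e" if "j \<le> n" for j
    using that W(1) unfolding dominant_limit_def by (intro exI[of _ "\<lambda>k. W (r k) j"]) simp
  with e show ?thesis by blast
qed

text \<open>Near-maximizers \<open>T k\<close> of node systems \<open>Z k\<close> tending to
  \<open>e\<close>. The finite limit of the translates is essential to its use: at the same
  \<open>T k\<close>, changing the nodes alters \<open>F\<close> only through \<open>f\<close>, by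
  an amount that tends to 0.\<close>

definition maximizing :: "real \<Rightarrow> nat \<Rightarrow> (nat \<Rightarrow> real) \<Rightarrow> (nat \<Rightarrow> nat \<Rightarrow> real) \<Rightarrow> (nat \<Rightarrow> real) \<Rightarrow> real \<Rightarrow> bool"
  where
  "maximizing c j e Z T t \<longleftrightarrow>
     (\<forall>k. Z k \<in> S \<and> T k \<in> {0..1} \<and> ereal c < F (Z k) (T k)) \<and>
     (\<forall>l\<in>{1..n}. (\<lambda>k. Z k l) \<longlonglongrightarrow> e l) \<and> T \<longlonglongrightarrow> t \<and> t \<in> I e j \<and>
     (\<lambda>k. f (Z k) (T k)) \<longlonglongrightarrow> f e t \<and> \<bar>f e t\<bar> \<noteq> \<infinity>"

lemma maximizingD:
  assumes "maximizing c j e Z T t"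
  shows "Z k \<in> S" "T k \<in> {0..1}" "ereal c < F (Z k) (T k)" "T \<longlonglongrightarrow> t" "t \<in> I e j"
    "(\<lambda>k. f (Z k) (T k)) \<longlonglongrightarrow> f e t" "\<bar>f e t\<bar> \<noteq> \<infinity>"
  using assms by (simp_all add: maximizing_def)

text \<open>At some fixed \<open>s\<close> the level \<open>c\<close> is exceeded for
  \<open>e\<close>, hence eventually for \<open>Y k\<close>, since only the translates vary.
  Dominance moves this excess into interval \<open>j\<close>, and compactness provides the limit
  point.\<close>

lemma dominant_limit_maximizing:
  assumes e: "e \<in> S" and j: "j \<le> n" and dom: "dominant_limit j e"
    and c: "ereal c < m_upper n \<nu> K J e"
  shows "\<exists>Z T t. maximizing c j e Z T t"
proof -
  obtain Y where Y: "\<And>k. Y k \<in> S" and Y_max: "\<And>k. m j (Y k) = m_upper n \<nu> K J (Y k)"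
    and Y_lim: "\<And>l. l \<in> {1..n} \<Longrightarrow> (\<lambda>k. Y k l) \<longlonglongrightarrow> e l"
    using dom unfolding dominant_limit_def by blast
  obtain C where C: "\<And>u. u \<in> {0..1} \<Longrightarrow> J u \<le> ereal C"
    using bounded_above by blast
  obtain i s where "i \<le> n" "s \<in> I e i" and s: "ereal c < F e s"
    using m_upper_attained[of e] c less_m[of "ereal c" _ e] by metis
  then have s01: "s \<in> {0..1}"
    using interval_subset[OF e] by blast
  have "(\<lambda>k. f (Y k) s) \<longlonglongrightarrow> f e s"
    using Y Y_lim e s01 by (intro translates_tendsto) auto
  then have "(\<lambda>k. F (Y k) s) \<longlonglongrightarrow> F e s"
    unfolding F_eq using C[OF s01] translates_not_PInf[OF e s01]
    by (intro tendsto_add_ereal_general tendsto_const) auto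
  then have "eventually (\<lambda>k. ereal c < F (Y k) s) sequentially"
    using s by (rule order_tendstoD)
  then have "eventually (\<lambda>k. ereal c < m j (Y k)) sequentially"
    by eventually_elim (use F_le_upper[OF Y s01] Y_max in \<open>auto intro: less_le_trans\<close>)
  then obtain N where N: "\<And>k. N \<le> k \<Longrightarrow> ereal c < m j (Y k)"
    unfolding eventually_sequentially by auto
  then have "\<exists>t\<in>I (Y (k + N)) j. ereal c < F (Y (k + N)) t" for k
    by (simp only: less_m[symmetric] le_add2)
  then obtain U where U: "\<And>k. U k \<in> I (Y (k + N)) j" and U_big: "\<And>k. ereal c < F (Y (k + N)) (U k)"
    by metis
  have U01: "\<forall>k. U k \<in> {0..1}"
    using U interval_subset[OF Y j] by blast
  have "seq_compact {0..1::real}"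
    using compact_imp_seq_compact compact_Icc by blast
  then obtain t r where t01: "t \<in> {0..1}" and r: "strict_mono (r :: nat \<Rightarrow> nat)" and "(U \<circ> r) \<longlonglongrightarrow> t"
    using U01 by (rule seq_compactE)
  define Z where "Z k = Y (r k + N)" for k
  define T where "T k = U (r k)" for k
  have T_lim: "T \<longlonglongrightarrow> t"
    using \<open>(U \<circ> r) \<longlonglongrightarrow> t\<close> by (simp add: T_def[abs_def] o_def)
  have Z: "Z k \<in> S" for k
    using Y by (simp add: Z_def)
  have Z_lim: "(\<lambda>k. Z k l) \<longlonglongrightarrow> e l" if "l \<in> {1..n}" for l
    using LIMSEQ_subseq_LIMSEQ[OF LIMSEQ_ignore_initial_segment[OF Y_lim[OF that], of N] r]
    by (simp add: Z_def o_def)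
  have T01: "T k \<in> {0..1}" for k
    using U01 by (simp add: T_def)
  have big: "ereal c < F (Z k) (T k)" for k
    using U_big by (simp add: Z_def T_def)
  have t: "t \<in> I e j"
  proof -
    have "(\<lambda>k. node n (Z k) i) \<longlonglongrightarrow> node n e i" if "i \<le> n + 1" for i
      using Z_lim[of i] that by (cases "i = 0 \<or> i = n + 1") (auto simp: node_def)
    then have "(\<lambda>k. node n (Z k) j) \<longlonglongrightarrow> node n e j"
      "(\<lambda>k. node n (Z k) (j + 1)) \<longlonglongrightarrow> node n e (j + 1)"
      using j by simp_all
    moreover have "node n (Z k) j \<le> T k" "T k \<le> node n (Z k) (j + 1)" for k
      using U by (simp_all add: Z_def T_def)
    ultimately have "node n e j \<le> t" "t \<le> node n e (j + 1)"
      using T_lim by (blast intro: LIMSEQ_le)+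
    then show ?thesis by simp
  qed
  have f_lim: "(\<lambda>k. f (Z k) (T k)) \<longlonglongrightarrow> f e t"
    using Z Z_lim T01 T_lim e t01 by (intro translates_tendsto) auto
  \<comment> \<open>The upper bound on the field keeps the translates away from -\<infinity>, so
    their limit is finite.\<close>
  have "ereal (c - C) \<le> f (Z k) (T k)" for k
    using big[of k] C[OF T01[of k]] unfolding F_eq
    by (cases "J (T k)"; cases "f (Z k) (T k)") auto
  then have "ereal (c - C) \<le> f e t"
    using f_lim by (intro Lim_bounded2[where N = 0]) auto
  then have "\<bar>f e t\<bar> \<noteq> \<infinity>"
    using translates_not_PInf[OF e t01] by (cases "f e t") auto
  then show ?thesis
    using Z Z_lim T01 big T_lim t f_lim unfolding maximizing_def
    by (intro exI[of _ Z] exI[of _ T] exI[of _ t]) simp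
qed

end

section \<open>Reduction of extended real inequalities to real levels\<close>

lemma ereal_le_by_reals:
  assumes "\<And>c. ereal c < a \<Longrightarrow> ereal c \<le> b"
  shows "a \<le> b"
proof (rule dense_le)
  fix x assume "x < a"
  then obtain c where "x < ereal c" "ereal c < a"
    using ereal_dense2 by blast
  with assms[of c] show "x \<le> b" by simp
qed

lemma ereal_le_by_eps:
  assumes "\<And>\<epsilon>. 0 < \<epsilon> \<Longrightarrow> ereal (c - \<epsilon>) \<le> b"
  shows "ereal c \<le> b"
proof (rule ereal_le_by_reals)
  fix x assume "ereal x < ereal c"
  with assms[of "c - x"] show "ereal x \<le> b" by simp
qed

section \<open>The minimax equality\<close>

context translates
begin

text \<open>
  Nodes separating the near-maximizers \<open>T j k\<close> are obtained from \<open>e\<close> by clamping; this also works when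
  the intervals of \<open>e\<close> degenerate.
\<close>

lemma interlacing_nodes:
  assumes e: "e \<in> S" and T01: "\<And>j k. j \<le> n \<Longrightarrow> T j k \<in> {0..1}"
    and T_lim: "\<And>j. j \<le> n \<Longrightarrow> T j \<longlonglongrightarrow> t j" and t: "\<And>j. j \<le> n \<Longrightarrow> t j \<in> I e j"
  shows "\<exists>y. (\<forall>k. y k \<in> S) \<and> (\<forall>l\<in>{1..n}. (\<lambda>k. y k l) \<longlonglongrightarrow> e l) \<and>
    (\<forall>j\<le>n. \<forall>k. \<exists>i\<le>n. T i k \<in> I (y k) j)"
proof -
  \<comment> \<open>Running maxima put the points in order. Their limits \<open>t j\<close> are
    already ordered, being separated by the nodes of \<open>e\<close>, so \<open>s j\<close> still
    tends to \<open>t j\<close>. Since \<open>s j k\<close> may be an earlier point, the index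
    \<open>i\<close> in the conclusion can differ from \<open>j\<close>.\<close>
  define s where "s j k = Max ((\<lambda>i. T i k) ` {..j})" for j k
  \<comment> \<open>This clamps \<open>e i\<close> to the range from \<open>s (i - 1) k\<close> to
    \<open>s i k\<close>; in the limit \<open>e i\<close> lies in that range, so the clamping
    vanishes.\<close>
  define y where "y k = restrict (\<lambda>i. max (s (i - 1) k) (min (e i) (s i k))) {1..n}" for k
  have s_mono: "s i k \<le> s j k" if "i \<le> j" for i j k
    unfolding s_def using that by (intro Max_mono image_mono) auto
  have s_in: "\<exists>i\<le>j. s j k = T i k" for j k
  proof -
    have "s j k \<in> (\<lambda>i. T i k) ` {..j}"
      unfolding s_def by (rule Max_in) auto
    then show ?thesis by auto
  qed
  have s01: "s j k \<in> {0..1}" if "j \<le> n" for j k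
    using s_in[of j k] T01[of _ k] that by force
  have y_between: "s (i - 1) k \<le> y k i" "y k i \<le> s i k" if "i \<in> {1..n}" for i k
    using that s_mono[of "i - 1" i k] by (auto simp: y_def)
  have y: "y k \<in> S" for k
    unfolding node_systems_def
  proof (intro CollectI conjI)
    show "y k \<in> {1..n} \<rightarrow>\<^sub>E {0..1}"
    proof (rule PiE_I)
      fix i assume i: "i \<in> {1..n}"
      then show "y k i \<in> {0..1}"
        using y_between[OF i, of k] s01[of "i - 1" k] s01[of i k] by force
    qed (auto simp: y_def)
    show "mono_on {1..n} (y k)"
    proof (rule monotone_onI)
      fix i j assume ij: "i \<in> {1..n}" "j \<in> {1..n}" "i \<le> j"
      show "y k i \<le> y k j"
      proof (cases "i = j")
        case False
        then have "s i k \<le> s (j - 1) k" using ij by (intro s_mono) auto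
        then show ?thesis
          using y_between[of i k] y_between[of j k] ij by linarith
      qed simp
    qed
  qed
  have t_le: "t j \<le> e (Suc j)" "e (Suc j) \<le> t (Suc j)" if "Suc j \<le> n" for j
    using t[of j] t[of "Suc j"] that by (auto simp: node_def)
  have s_lim: "s j \<longlonglongrightarrow> t j" if "j \<le> n" for j
    using that
  proof (induction j)
    case 0
    then show ?case using T_lim[of 0] by (simp add: s_def[abs_def])
  next
    case (Suc j)
    have "s (Suc j) = (\<lambda>k. max (T (Suc j) k) (s j k))"
      by (simp add: s_def atMost_Suc fun_eq_iff)
    moreover have "(\<lambda>k. max (T (Suc j) k) (s j k)) \<longlonglongrightarrow> max (t (Suc j)) (t j)"
      using Suc by (intro tendsto_max T_lim) auto
    moreover have "max (t (Suc j)) (t j) = t (Suc j)"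
      using t_le[OF Suc.prems] by simp
    ultimately show ?case by (simp only:)
  qed
  have y_lim: "(\<lambda>k. y k i) \<longlonglongrightarrow> e i" if i: "i \<in> {1..n}" for i
  proof -
    have "(\<lambda>k. max (s (i - 1) k) (min (e i) (s i k))) \<longlonglongrightarrow> max (t (i - 1)) (min (e i) (t i))"
      using i by (intro tendsto_max tendsto_min tendsto_const s_lim) auto
    moreover have "max (t (i - 1)) (min (e i) (t i)) = e i"
      using t_le[of "i - 1"] i by auto
    ultimately show ?thesis using i by (simp add: y_def)
  qed
  have "s j k \<in> I (y k) j" if "j \<le> n" for j k
    using y_between[of j k] y_between[of "Suc j" k] s01[OF that, of k] that by (auto simp: node_def)
  then have "\<exists>i\<le>n. T i k \<in> I (y k) j" if "j \<le> n" for j k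
    using s_in[of j k] that by (metis order_trans)
  with y y_lim show ?thesis by (intro exI[of _ y]) simp
qed

text \<open>Each index \<open>j\<close> has its own systems \<open>Z j k\<close>. Replacing them by
  common interlacing systems \<open>y k\<close> costs at most \<open>\<epsilon>\<close> at
  \<open>T j k\<close>, because both sequences of translates have the same finite limit. Then every
  interval of \<open>y k\<close> contains a point of value at least
  \<open>c - \<epsilon>\<close>.\<close>

lemma dominant_limit_le_maximin:
  assumes e: "e \<in> S" and dom: "\<And>j. j \<le> n \<Longrightarrow> dominant_limit j e"
  shows "m_upper n \<nu> K J e \<le> maximin n \<nu> K J"
proof (rule ereal_le_by_reals, rule ereal_le_by_eps)
  fix c \<epsilon> :: real
  assume c: "ereal c < m_upper n \<nu> K J e" and "0 < \<epsilon>"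
  have "\<exists>p. \<forall>j. j \<le> n \<longrightarrow> maximizing c j e (fst (p j)) (fst (snd (p j))) (snd (snd (p j)))"
  proof (rule choice, rule allI)
    fix j
    show "\<exists>p. j \<le> n \<longrightarrow> maximizing c j e (fst p) (fst (snd p)) (snd (snd p))"
      using dominant_limit_maximizing[OF e _ dom c, of j] by (cases "j \<le> n") auto
  qed
  then obtain p where p: "\<forall>j. j \<le> n \<longrightarrow> maximizing c j e (fst (p j)) (fst (snd (p j))) (snd (snd (p j)))" ..
  define Z T t where "Z j = fst (p j)" and "T j = fst (snd (p j))" and "t j = snd (snd (p j))" for j
  then have max: "maximizing c j e (Z j) (T j) (t j)" if "j \<le> n" for j
    using p that by simp
  note Z = maximizingD(1)[OF max] and T = maximizingD(2,3,4)[OF max] and t = maximizingD(5)[OF max]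
    and f_lim = maximizingD(6)[OF max] and f_real = maximizingD(7)[OF max]
  obtain y where "(\<forall>k. y k \<in> S) \<and> (\<forall>l\<in>{1..n}. (\<lambda>k. y k l) \<longlonglongrightarrow> e l) \<and>
      (\<forall>j\<le>n. \<forall>k. \<exists>i\<le>n. T i k \<in> I (y k) j)"
    using interlacing_nodes[OF e T(1) T(3) t] ..
  then have y: "\<And>k. y k \<in> S" "\<And>l. l \<in> {1..n} \<Longrightarrow> (\<lambda>k. y k l) \<longlonglongrightarrow> e l"
    and T_in: "\<And>j k. j \<le> n \<Longrightarrow> \<exists>i\<le>n. T i k \<in> I (y k) j"
    by simp_all
  have "eventually (\<lambda>k. ereal (c - \<epsilon>) \<le> F (y k) (T j k)) sequentially" if j: "j \<le> n" for j
  proof -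
    have t01: "t j \<in> {0..1}" using t[OF j] interval_subset[OF e j] by blast
    obtain a where a: "f e (t j) = ereal a" using f_real[OF j] by auto
    have "(\<lambda>k. f (y k) (T j k)) \<longlonglongrightarrow> ereal a"
      unfolding a[symmetric] using y T(1)[OF j] T(3)[OF j] by (intro translates_tendsto e t01) auto
    then have "eventually (\<lambda>k. ereal (a - \<epsilon> / 2) < f (y k) (T j k)) sequentially"
      using \<open>0 < \<epsilon>\<close> by (intro order_tendstoD) auto
    moreover have "eventually (\<lambda>k. f (Z j k) (T j k) < ereal (a + \<epsilon> / 2)) sequentially"
      using f_lim[OF j] \<open>0 < \<epsilon>\<close> unfolding a by (intro order_tendstoD) auto
    ultimately show ?thesis
    proof eventually_elim
      case (elim k)
      have "f (y k) (T j k) \<noteq> \<infinity>" "f (Z j k) (T j k) \<noteq> \<infinity>"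
        using translates_not_PInf y(1) Z[OF j] T(1)[OF j] by blast+
      then show ?case
        using elim T(2)[OF j, of k] unfolding F_eq
        by (cases "J (T j k)"; cases "f (y k) (T j k)"; cases "f (Z j k) (T j k)") auto
    qed
  qed
  then have "eventually (\<lambda>k. \<forall>j\<in>{..n}. ereal (c - \<epsilon>) \<le> F (y k) (T j k)) sequentially"
    by (intro eventually_ball_finite) auto
  then obtain k where k: "\<And>j. j \<le> n \<Longrightarrow> ereal (c - \<epsilon>) \<le> F (y k) (T j k)"
    unfolding eventually_sequentially by auto
  have "ereal (c - \<epsilon>) \<le> m_lower n \<nu> K J (y k)"
  proof (rule le_m_lower)
    fix j assume "j \<le> n"
    then obtain i where "i \<le> n" "T i k \<in> I (y k) j" using T_in by blast
    then show "ereal (c - \<epsilon>) \<le> m j (y k)"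
      using k[of i] F_le_m order_trans by blast
  qed
  also have "\<dots> \<le> maximin n \<nu> K J"
    unfolding maximin_def using y(1) by (rule SUP_upper)
  finally show "ereal (c - \<epsilon>) \<le> maximin n \<nu> K J" .
qed

section \<open>Consequences of the interval comparison\<close>

lemma no_strict_majorization:
  assumes "x \<in> S" "y \<in> S"
  shows "\<exists>i\<le>n. m i x \<le> m i y"
proof -
  obtain i where i: "i \<le> n" "I x i \<subseteq> I y i" "\<And>t. t \<in> I x i \<Longrightarrow> F x t \<le> F y t"
    using assms by (rule interval_comparison) blast
  then have "m i x \<le> m i y"
    unfolding interval_max_def by (intro SUP_subset_mono) auto
  with i(1) show ?thesis by blast
qed

lemma maximin_le_minimax: "maximin n \<nu> K J \<le> minimax n \<nu> K J"
  unfolding maximin_def minimax_def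
proof (intro SUP_least INF_greatest)
  fix x y assume "x \<in> S" "y \<in> S"
  then obtain i where i: "i \<le> n" "m i x \<le> m i y"
    using no_strict_majorization by blast
  then show "m_lower n \<nu> K J x \<le> m_upper n \<nu> K J y"
    using m_lower_le[OF i(1), of x] m_le_upper[OF i(1), of y] by order
qed

section \<open>Equioscillation at a common dominant limit\<close>

lemma singular_translates: "singular_kernel K \<Longrightarrow> e \<in> S \<Longrightarrow> l \<in> {1..n} \<Longrightarrow> f e (e l) = -\<infinity>"
  using translates_finite(1)[of e "e l"] nodes_in[of e l] unfolding singular_kernel_def
  by (metis diff_self)

text \<open>For upper semicontinuous \<open>J\<close> the limit point \<open>t\<close> itself has
  value at least \<open>c\<close>. For singular \<open>K\<close>, finiteness of \<open>f e t\<close>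
  keeps \<open>t\<close> off the nodes, so the points \<open>T k\<close> finally lie in the interval
  of \<open>e\<close> and serve there with a small loss.\<close>

lemma equioscillation_dominant_limit:
  assumes e: "e \<in> S" and j: "j \<le> n" and dom: "dominant_limit j e"
    and "usc_on {0..1} J \<or> singular_kernel K"
  shows "m j e = m_upper n \<nu> K J e"
proof (rule antisym[OF m_le_upper[OF j]], rule ereal_le_by_reals)
  fix c assume c: "ereal c < m_upper n \<nu> K J e"
  obtain Z T t where max: "maximizing c j e Z T t"
    using dominant_limit_maximizing[OF e j dom c] by blast
  have Z: "\<And>k. Z k \<in> S"
    and T: "\<And>k. T k \<in> {0..1}" "\<And>k. ereal c < F (Z k) (T k)" "T \<longlonglongrightarrow> t"
    and t: "t \<in> I e j" and f_lim: "(\<lambda>k. f (Z k) (T k)) \<longlonglongrightarrow> f e t" and f_real: "\<bar>f e t\<bar> \<noteq> \<infinity>"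
    using maximizingD[OF max] by blast+
  have t01: "t \<in> {0..1}" using t interval_subset[OF e j] by blast
  obtain a where a: "f e t = ereal a" using f_real by auto
  from \<open>usc_on {0..1} J \<or> singular_kernel K\<close> show "ereal c \<le> m j e"
  proof
    assume "usc_on {0..1} J"
    then have usc: "Limsup (at t within {0..1}) J \<le> J t"
      using t01 by (simp add: usc_on_def)
    have "ereal c \<le> F e t"
    proof (rule ccontr)
      assume "\<not> ereal c \<le> F e t"
      then have "J t < ereal (c - a)"
        unfolding F_eq a by (cases "J t") auto
      \<comment> \<open>\<open>b\<close> splits the level: \<open>J (T k) < b\<close> and translates
        below \<open>c - b\<close> together contradict a value above \<open>c\<close>.\<close>
      then obtain b where b: "J t < ereal b" "b < c - a"
        using ereal_dense2[of "J t" "ereal (c - a)"] by auto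
      have "eventually (\<lambda>u. J u < ereal b) (at t within {0..1})"
        by (rule Limsup_lessD) (use usc b in order)
      \<comment> \<open>\<open>Limsup\<close> at \<open>t\<close> ignores the value at
        \<open>t\<close>; the bound \<open>J t < b\<close> fills this gap, as \<open>T k = t\<close>
        is possible.\<close>
      then have "eventually (\<lambda>u. u \<in> {0..1} \<longrightarrow> J u < ereal b) (nhds t)"
        unfolding eventually_at_filter by eventually_elim (use b(1) in auto)
      then have "eventually (\<lambda>k. T k \<in> {0..1} \<longrightarrow> J (T k) < ereal b) sequentially"
        using T(3) by (rule eventually_compose_filterlim)
      moreover have "eventually (\<lambda>k. f (Z k) (T k) < ereal (c - b)) sequentially"
        using f_lim b(2) unfolding a by (intro order_tendstoD) auto
      ultimately have "eventually (\<lambda>k. False) sequentially"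
      proof eventually_elim
        case (elim k)
        then show ?case
          using T(1,2)[of k] unfolding F_eq
          by (cases "J (T k)"; cases "f (Z k) (T k)") auto
      qed
      then show False by simp
    qed
    with F_le_m[OF t] show ?thesis by order
  next
    assume sing: "singular_kernel K"
    have ne: "t \<noteq> e l" if "l \<in> {1..n}" for l
      using singular_translates[OF sing e that] a by auto
    \<comment> \<open>The outer ends 0 and 1 belong to no translate, but there
      \<open>T k \<in> {0..1}\<close> is enough.\<close>
    have "eventually (\<lambda>k. node n e j \<le> T k) sequentially"
    proof (cases "j = 0")
      case False
      then have "e j < t" using t ne[of j] j by (auto simp: node_def)
      with T(3) have "eventually (\<lambda>k. e j < T k) sequentially" by (rule order_tendstoD)
      then show ?thesis by eventually_elim (use False j in \<open>auto simp: node_def\<close>)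
    qed (use T(1) in \<open>auto simp: node_def\<close>)
    moreover have "eventually (\<lambda>k. T k \<le> node n e (j + 1)) sequentially"
    proof (cases "j = n")
      case False
      then have "t < e (j + 1)" using t ne[of "j + 1"] j by (auto simp: node_def)
      with T(3) have "eventually (\<lambda>k. T k < e (j + 1)) sequentially" by (rule order_tendstoD)
      then show ?thesis by eventually_elim (use False j in \<open>auto simp: node_def\<close>)
    qed (use T(1) in \<open>auto simp: node_def\<close>)
    ultimately have T_in: "eventually (\<lambda>k. T k \<in> I e j) sequentially"
      by eventually_elim auto
    show ?thesis
    proof (rule ereal_le_by_eps)
      fix \<epsilon> :: real assume "0 < \<epsilon>"
      have "(\<lambda>k. f e (T k)) \<longlonglongrightarrow> ereal a"
        unfolding a[symmetric] using T(1) T(3) by (intro translates_tendsto e t01) auto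
      then have "eventually (\<lambda>k. ereal (a - \<epsilon> / 2) < f e (T k)) sequentially"
        using \<open>0 < \<epsilon>\<close> by (intro order_tendstoD) auto
      moreover have "eventually (\<lambda>k. f (Z k) (T k) < ereal (a + \<epsilon> / 2)) sequentially"
        using f_lim \<open>0 < \<epsilon>\<close> unfolding a by (intro order_tendstoD) auto
      ultimately have "eventually (\<lambda>k. T k \<in> I e j \<and> ereal (c - \<epsilon>) \<le> F e (T k)) sequentially"
        using T_in
      proof eventually_elim
        case (elim k)
        have "f e (T k) \<noteq> \<infinity>" "f (Z k) (T k) \<noteq> \<infinity>"
          using translates_not_PInf e Z T(1) by blast+
        with elim show ?case
          using T(2)[of k] unfolding F_eq
          by (cases "J (T k)"; cases "f e (T k)"; cases "f (Z k) (T k)") auto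
      qed
      then obtain k where "T k \<in> I e j" "ereal (c - \<epsilon>) \<le> F e (T k)"
        unfolding eventually_sequentially by auto
      then show "ereal (c - \<epsilon>) \<le> m j e"
        using F_le_m order_trans by blast
    qed
  qed
qed

end

theorem theorem1p3:
  fixes n :: nat and \<nu> :: "nat \<Rightarrow> real" and K :: "real \<Rightarrow> real" and J :: "real \<Rightarrow> ereal"
  assumes "\<forall>j\<in>{1..n}. \<nu> j > 0"
    and "kernel_function K" and "monotone_kernel K"
    and "field_function n J"
  shows "minimax n \<nu> K J = maximin n \<nu> K J
    \<and> (\<exists>w\<in>node_systems n. m_upper n \<nu> K J w = minimax n \<nu> K J
         \<and> (\<forall>x\<in>node_systems n. m_upper n \<nu> K J w \<le> m_upper n \<nu> K J x))
    \<and> (\<forall>e. equioscillation_point n \<nu> K J e \<longrightarrow> m_upper n \<nu> K J e = minimax n \<nu> K J)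
    \<and> (usc_on {0..1} J \<or> singular_kernel K \<longrightarrow> (\<exists>e. equioscillation_point n \<nu> K J e))
    \<and> \<not> (\<exists>x\<in>regular_nodes n \<nu> K J. \<exists>y\<in>regular_nodes n \<nu> K J.
           \<forall>i\<in>{0..n}. interval_max n \<nu> K J i x > interval_max n \<nu> K J i y)"
proof -
  interpret translates n \<nu> K J
    using assms by unfold_locales (auto simp: field_function_def)
  have minimax_le: "minimax n \<nu> K J \<le> m_upper n \<nu> K J x" if "x \<in> S" for x
    unfolding minimax_def using that by (rule INF_lower)
  have le_maximin: "m_lower n \<nu> K J x \<le> maximin n \<nu> K J" if "x \<in> S" for x
    unfolding maximin_def using that by (rule SUP_upper)
  obtain e where e: "e \<in> S" and dom: "\<And>j. j \<le> n \<Longrightarrow> dominant_limit j e"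
    using common_dominant_limit by blast
  have upper_e: "m_upper n \<nu> K J e \<le> maximin n \<nu> K J"
    by (rule dominant_limit_le_maximin[OF e dom])
  have minimax_eq: "minimax n \<nu> K J = maximin n \<nu> K J"
    using minimax_le[OF e] upper_e maximin_le_minimax by (intro antisym) auto
  moreover have e_min: "m_upper n \<nu> K J e = minimax n \<nu> K J"
    using minimax_le[OF e] upper_e minimax_eq by (intro antisym) simp_all
  moreover have "\<forall>x\<in>S. m_upper n \<nu> K J e \<le> m_upper n \<nu> K J x"
    using minimax_le e_min by simp
  moreover have "\<forall>x. equioscillation_point n \<nu> K J x \<longrightarrow> m_upper n \<nu> K J x = minimax n \<nu> K J"
  proof (intro allI impI)
    fix x assume "equioscillation_point n \<nu> K J x"
    then have x: "x \<in> S" and m_eq: "\<forall>i\<in>{0..n}. \<forall>j\<in>{0..n}. m i x = m j x"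
      unfolding equioscillation_point_def by blast+
    obtain i where i: "i \<le> n \<and> m_upper n \<nu> K J x = m i x"
      using m_upper_attained[of x] ..
    \<comment> \<open>At an equioscillation point the largest and smallest interval maxima agree, so
      their common value lies between \<open>minimax\<close> and \<open>maximin\<close>, which are
      equal.\<close>
    have "m_upper n \<nu> K J x \<le> m_lower n \<nu> K J x"
    proof (rule le_m_lower)
      fix j assume "j \<le> n"
      then have "m i x = m j x" using i by (intro m_eq[rule_format]) auto
      then show "m_upper n \<nu> K J x \<le> m j x" using i by simp
    qed
    then show "m_upper n \<nu> K J x = minimax n \<nu> K J"
      using le_maximin[OF x] minimax_le[OF x] minimax_eq by (intro antisym) auto
  qed
  moreover have "equioscillation_point n \<nu> K J e" if "usc_on {0..1} J \<or> singular_kernel K"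
    unfolding equioscillation_point_def
    using equioscillation_dominant_limit[OF e _ dom that] e by simp
  moreover have "\<not> (\<exists>x\<in>regular_nodes n \<nu> K J. \<exists>y\<in>regular_nodes n \<nu> K J. \<forall>i\<in>{0..n}. m i x > m i y)"
  proof safe
    fix x y assume "x \<in> regular_nodes n \<nu> K J" "y \<in> regular_nodes n \<nu> K J"
      and less: "\<forall>i\<in>{0..n}. m i y < m i x"
    then obtain i where "i \<le> n" "m i x \<le> m i y"
      using no_strict_majorization[of x y] by (auto simp: regular_nodes_def)
    moreover from this have "m i y < m i x" using less by simp
    ultimately show False by simp
  qed
  ultimately show ?thesis using e by blast
qed

end
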